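(* Let $\mathcal{K}\subset[0,1]$ be the limit set of a geometric construction by closed intervals $\Delta_{i_0\dots i_{n-1}}$ of lengths $r_{i_0\dots i_{n-1}}$, indexed by all finite words over $\mathbb{N}$. Assume that there exists $C>0$ such that for every $n,m\in\mathbb{N}$ and every word $i_0\dots i_{n+m-1}$ over $\mathbb{N}$, $$r_{i_0\dots i_{n-1}}\,r_{i_n\dots i_{n+m-1}}\,e^{-C}\le r_{i_0\dots i_{n+m-1}}\le r_{i_0\dots i_{n-1}}\,r_{i_n\dots i_{n+m-1}}\,e^{C}.$$ Let $\mathcal{F}=\{\phi_n\}_{n=1}^\infty$, where $\phi_n(x)=\log r_{i_0\dots i_{n-1}}$ for $x\in C_{i_0\dots i_{n-1}}$. Then $$\dim_H(\mathcal{K})=\inf\{t\in\mathbb{R}: P(t\mathcal{F})\le 0\}.$$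
   Context: Geometric construction: for every $n\in\mathbb{N}$ let $\Delta_n\subset[0,1]$ be a closed interval of length $r_n>0$, with $\Delta_m\cap\Delta_n=\emptyset$ for $m\ne n$. Inductively, for each interval $\Delta_{i_0\dots i_{n-1}}$ one chooses a countable family of pairwise disjoint closed intervals $\{\Delta_{i_0\dots i_{n-1}m}\}_{m\in\mathbb{N}}$ with $\Delta_{i_0\dots i_{n-1}m}\subset\Delta_{i_0\dots i_{n-1}}$, and $r_{i_0\dots i_{n-1}m}>0$ denotes the length of $\Delta_{i_0\dots i_{n-1}m}$. The limit set is $\mathcal{K}=\bigcap_{n=1}^\infty\bigcup_{(i_0\dots i_{n-1})\in\mathbb{N}^n}\Delta_{i_0\dots i_{n-1}}$. $\dim_H$ denotes Hausdorff dimension. $(\Sigma_F,\sigma)$ is the full shift on the alphabet $\mathbb{N}$: $\Sigma_F=\{(x_i)_{i=0}^\infty:x_i\in\mathbb{N}\}$, $(\sigma x)_n=x_{n+1}$, with cylinders $C_{i_0\dots i_{n-1}}=\{x\in\Sigma_F:x_j=i_j,\ 0\le j\le n-1\}$; the functions $\phi_n$ are defined on $\Sigma_F$. For $t\in\mathbb{R}$, $t\mathcal{F}=\{t\phi_n\}_{n=1}^\infty$ and $P(t\mathcal{F})$ is the almost-additive Gurevich pressure $$P(t\mathcal{F})=\lim_{n\to\infty}\frac1n\log\sum_{\sigma^nx=x}e^{t\phi_n(x)}\chi_{C_a}(x),$$ where $a\in\mathbb{N}$ and $\chi_{C_a}$ is the characteristic function of $C_a$; the limit exists in $(-\infty,\infty]$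 and does not depend on $a$. *)

theory Defs
  imports "HOL-Analysis.Analysis"
begin

section \<open>Hausdorff dimension\<close>

text \<open>
  The weight \<open>(diam U)\<^sup>s\<close> of a covering set, with the conventions that the empty set has weight 0
  and that \<open>0\<^sup>0 = 1\<close>, so that the 0-dimensional measure is the counting measure.
  (Isabelle's \<^term>\<open>(powr)\<close> has \<open>0 powr 0 = 0\<close>.)
\<close>
definition hausdorff_weight :: "real \<Rightarrow> 'a::metric_space set \<Rightarrow> real" where
  "hausdorff_weight s U =
     (if U = {} then 0 else if s = 0 then 1 else diameter U powr s)"

text \<open>
  Boundedness of the covering sets is required because \<^term>\<open>diameter\<close> is unspecified on
  unbounded sets. Covers are sequences; since empty members are allowed and weigh nothing,
  finite covers are included.
\<close>
definition hausdorff_premeasure :: "real \<Rightarrow> real \<Rightarrow> 'a::metric_space set \<Rightarrow> ennreal" where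
  "hausdorff_premeasure s \<delta> A =
     (INF U \<in> {U :: nat \<Rightarrow> 'a set. A \<subseteq> (\<Union>i. U i) \<and> (\<forall>i. bounded (U i) \<and> diameter (U i) \<le> \<delta>)}.
        \<Sum>i. ennreal (hausdorff_weight s (U i)))"

definition hausdorff_measure :: "real \<Rightarrow> 'a::metric_space set \<Rightarrow> ennreal" where
  "hausdorff_measure s A = (SUP \<delta> \<in> {0<..}. hausdorff_premeasure s \<delta> A)"

definition hausdorff_dim :: "'a::metric_space set \<Rightarrow> ereal" where
  "hausdorff_dim A = (INF s \<in> {s. 0 \<le> s \<and> hausdorff_measure s A = 0}. ereal s)"


section \<open>The full shift on a countable alphabet and Gurevich pressure\<close>

definition full_shift :: "(nat \<Rightarrow> nat) \<Rightarrow> nat \<Rightarrow> nat" where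
  "full_shift x = (\<lambda>n. x (Suc n))"

definition cylinder :: "nat list \<Rightarrow> (nat \<Rightarrow> nat) set" where
  "cylinder w = {x. \<forall>j < length w. x j = w ! j}"

definition ln_ennreal :: "ennreal \<Rightarrow> ereal" where
  "ln_ennreal z = (if z = 0 then - \<infinity> else if z = \<infinity> then \<infinity> else ereal (ln (enn2real z)))"

text \<open>
  The pressure of a sequence \<open>\<phi>\<^sub>1, \<phi>\<^sub>2, \<dots>\<close>, computed on the cylinder of the symbol \<open>a\<close>
  (the entry \<open>\<phi> 0\<close> plays no role). The partition functions are sums over infinitely many
  periodic points and may be infinite, hence are taken in \<^typ>\<open>ennreal\<close>.
\<close>
definition gurevich_pressure :: "nat \<Rightarrow> (nat \<Rightarrow> (nat \<Rightarrow> nat) \<Rightarrow> real) \<Rightarrow> ereal" where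
  "gurevich_pressure a \<phi> =
     lim (\<lambda>n. ereal (1 / real n) *
       ln_ennreal (\<Sum>\<^sub>\<infinity>x \<in> {x. (full_shift ^^ n) x = x}.
         ennreal (exp (\<phi> n x) * indicator (cylinder [a]) x)))"


section \<open>Geometric constructions\<close>

text \<open>
  Words are lists over \<^typ>\<open>nat\<close>; only nonempty words index intervals, so \<open>\<Delta> []\<close> and \<open>r []\<close>
  are irrelevant. The case \<open>w = []\<close> of the last assumption is the disjointness of the
  first-level intervals.
\<close>
locale geometric_construction =
  fixes \<Delta> :: "nat list \<Rightarrow> real set" and r :: "nat list \<Rightarrow> real"
  assumes length_pos: "w \<noteq> [] \<Longrightarrow> r w > 0"
    and closed_interval: "w \<noteq> [] \<Longrightarrow> \<exists>b. \<Delta> w = {b .. b + r w}"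
    and in_unit_interval: "\<Delta> [i] \<subseteq> {0..1}"
    and nested: "w \<noteq> [] \<Longrightarrow> \<Delta> (w @ [m]) \<subseteq> \<Delta> w"
    and siblings_disjoint: "m \<noteq> n \<Longrightarrow> \<Delta> (w @ [m]) \<inter> \<Delta> (w @ [n]) = {}"

definition limit_set :: "(nat list \<Rightarrow> real set) \<Rightarrow> real set" where
  "limit_set \<Delta> = (\<Inter>n \<in> {1..}. \<Union>w \<in> {w. length w = n}. \<Delta> w)"

end

theory Submission
  imports Defs "HOL-Library.Sublist"
begin

text \<open>
  Put \<open>Z t n = (\<Sum>|w| = n. r w powr t)\<close>. Up to factors \<open>exp (\<plusminus>\<bar>t\<bar> C)\<close> it is multiplicative in \<open>n\<close>, so
  \<open>ln (Z t n)\<close> stays within \<open>\<bar>t\<bar> C\<close> of \<open>n P\<close> for the pressure \<open>P\<close>, and \<open>P \<le> 0\<close> iff \<open>Z t n \<le> exp (\<bar>t\<bar> C)\<close> for all \<open>n \<ge> 1\<close>.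

  Each interval has two disjoint children of proportional length, so lengths decay exponentially
  in the level; a bound on \<open>Z t n\<close> thus makes the level-\<open>n\<close> covers show that the Hausdorff measure
  of every exponent \<open>t' > t\<close> vanishes.

  If on the other hand \<open>Z s n > exp (s C)\<close>, then already the sum over some finite set \<open>W\<close> of words
  of length \<open>n\<close> exceeds \<open>exp (s C)\<close>, and \<open>q w = (exp (- C) * r w) powr s\<close> has total mass at least 1 on \<open>W\<close>. A set of
  diameter \<open>l\<close> meets boundedly many intervals of length about \<open>l\<close> indexed by concatenations of
  words of \<open>W\<close>. If a cover had small total weight, the intervals so obtained would have total
  \<open>q\<close>-mass below 1, and some infinite concatenation would avoid them all: its point of the limit
  set would not be covered.
\<close>

section \<open>Quasi-additive real sequences\<close>

text \<open>A two-sided Fekete argument: \<open>z (n * m)\<close> is compared with both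
  \<open>m * z n\<close> and \<open>n * z m\<close>, which makes \<open>z n / n\<close> Cauchy with
  the explicit error \<open>D / n + D / m\<close>. Letting \<open>m\<close> tend to infinity and
  multiplying by \<open>n\<close> leaves an error \<open>D\<close> independent of
  \<open>n\<close>.\<close>

lemma quasi_additive_linear:
  fixes z :: "nat \<Rightarrow> real"
  assumes qa: "\<And>n m. n \<ge> 1 \<Longrightarrow> m \<ge> 1 \<Longrightarrow> \<bar>z (n + m) - z n - z m\<bar> \<le> D"
  obtains L where "(\<lambda>n. z n / real n) \<longlonglongrightarrow> L" and "\<And>n. n \<ge> 1 \<Longrightarrow> \<bar>z n - n * L\<bar> \<le> D"
proof -
  have D: "0 \<le> D"
    using qa[of 1 1] by linarith
  have mult: "\<bar>z (n * m) - m * z n\<bar> \<le> m * D" if "n \<ge> 1" "m \<ge> 1" for n m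
    using \<open>m \<ge> 1\<close>
  proof (induction m rule: dec_induct)
    case base
    then show ?case using D by simp
  next
    case (step m)
    have "\<bar>z (n * m + n) - z (n * m) - z n\<bar> \<le> D"
      using qa[of "n * m" n] that step.hyps by simp
    then show ?case
      using step.IH by (simp add: algebra_simps)
  qed
  have quot: "\<bar>z (n * m) / (n * m) - z n / n\<bar> \<le> D / n" if "n \<ge> 1" "m \<ge> 1" for n m
  proof -
    have "z (n * m) / (n * m) - z n / n = (z (n * m) - m * z n) / (n * m)"
      using that by (simp add: field_simps)
    then have "\<bar>z (n * m) / (n * m) - z n / n\<bar> = \<bar>z (n * m) - m * z n\<bar> / (n * m)"
      by (simp add: abs_mult)
    also have "\<dots> \<le> m * D / (n * m)"
      using mult[OF that] by (intro divide_right_mono) auto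
    also have "\<dots> = D / n"
      using that by (simp add: field_simps)
    finally show ?thesis .
  qed
  have diff: "\<bar>z n / n - z m / m\<bar> \<le> D / n + D / m" if "n \<ge> 1" "m \<ge> 1" for n m
    using quot[of n m] quot[of m n] that by (simp add: mult.commute)
  have "Cauchy (\<lambda>n. z n / n)"
  proof (rule CauchyI')
    fix e :: real assume e: "e > 0"
    obtain N :: nat where N: "2 * D / e < N"
      using reals_Archimedean2 by blast
    have N1: "D / n < e / 2" if "n \<ge> Suc N" for n
    proof -
      have "2 * D / e < n" using N that by linarith
      then show ?thesis using e that by (simp add: field_simps)
    qed
    have "dist (z m / m) (z n / n) < e" if "m \<ge> Suc N" "n > m" for m n
      using diff[of m n] N1[of m] N1[of n] that unfolding dist_real_def by linarith
    then show "\<exists>M. \<forall>m\<ge>M. \<forall>n>m. dist (z m / m) (z n / n) < e"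
      by blast
  qed
  then obtain L where L: "(\<lambda>n. z n / n) \<longlonglongrightarrow> L"
    using Cauchy_convergent_iff convergent_def by blast
  have "\<bar>z n - n * L\<bar> \<le> D" if n: "n \<ge> 1" for n
  proof -
    have lim0: "(\<lambda>m. D / n + D / real m) \<longlonglongrightarrow> D / n + 0"
      by (intro tendsto_add tendsto_const lim_const_over_n)
    have "(\<lambda>m. \<bar>z n / n - z m / m\<bar>) \<longlonglongrightarrow> \<bar>z n / n - L\<bar>"
      by (intro tendsto_intros L)
    then have "\<bar>z n / n - L\<bar> \<le> D / n + 0"
      by (rule LIMSEQ_le[OF _ lim0]) (use diff n in \<open>auto intro!: exI[of _ 1]\<close>)
    then have "n * \<bar>z n / n - L\<bar> \<le> D"
      using n by (simp add: field_simps)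
    moreover have "n * \<bar>z n / n - L\<bar> = \<bar>n * (z n / n - L)\<bar>"
      by (simp add: abs_mult)
    ultimately show ?thesis
      using n by (simp add: right_diff_distrib)
  qed
  with L that show thesis by blast
qed

section \<open>Lengths of disjoint intervals and sums over countable sets\<close>

lemma sum_length_disjoint_intervals_le:
  fixes x l :: "'b \<Rightarrow> real"
  assumes "finite F"
    and "\<And>i. i \<in> F \<Longrightarrow> 0 \<le> l i"
    and sub: "\<And>i. i \<in> F \<Longrightarrow> {x i .. x i + l i} \<subseteq> {A..B}"
    and disj: "\<And>i j. i \<in> F \<Longrightarrow> j \<in> F \<Longrightarrow> i \<noteq> j \<Longrightarrow> {x i .. x i + l i} \<inter> {x j .. x j + l j} = {}"
    and "A \<le> B"
  shows "(\<Sum>i\<in>F. l i) \<le> B - A"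
proof -
  have "(\<Sum>i\<in>F. l i) = (\<Sum>i\<in>F. measure lborel {x i .. x i + l i})"
    using assms(2) by (intro sum.cong) auto
  also have "\<dots> = measure lborel (\<Union>i\<in>F. {x i .. x i + l i})"
    using assms(1) disj by (intro measure_finite_Union[symmetric]) (auto simp: disjoint_family_on_def emeasure_lborel_Icc_eq)
  also have "\<dots> \<le> measure lborel {A..B}"
  proof (rule measure_mono_fmeasurable)
    show "(\<Union>i\<in>F. {x i .. x i + l i}) \<subseteq> {A..B}"
      using sub by blast
    show "(\<Union>i\<in>F. {x i .. x i + l i}) \<in> sets lborel"
      using assms(1) by (intro sets.finite_UN) auto
    show "{A..B} \<in> fmeasurable lborel"
      by (rule fmeasurableI) (auto simp: emeasure_lborel_Icc_eq)
  qed
  also have "\<dots> = B - A"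
    using \<open>A \<le> B\<close> by simp
  finally show ?thesis .
qed

text \<open>Links the sums in the pressure with counting-measure integrals, for which reindexing and
  Tonelli are at hand. Countability allows an exhaustion by finite sets, to which monotone
  convergence applies.\<close>

lemma infsum_ennreal_eq_nn_integral:
  fixes f :: "'b::countable \<Rightarrow> ennreal"
  shows "(\<Sum>\<^sub>\<infinity>x\<in>A. f x) = (\<integral>\<^sup>+x. f x \<partial>count_space A)"
proof (rule antisym)
  have fin: "sum f F = (\<integral>\<^sup>+x. f x * indicator F x \<partial>count_space A)" if "finite F" "F \<subseteq> A" for F
  proof -
    have "(\<integral>\<^sup>+x. f x * indicator F x \<partial>count_space A) = (\<integral>\<^sup>+x. f x * indicator F x \<partial>count_space F)"
      using that by (intro nn_integral_count_space_eq) auto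
    then show ?thesis
      using that by (simp add: nn_integral_count_space_finite)
  qed
  show "(\<Sum>\<^sub>\<infinity>x\<in>A. f x) \<le> (\<integral>\<^sup>+x. f x \<partial>count_space A)"
    unfolding nonneg_infsum_complete[OF zero_le]
    by (auto intro!: SUP_least nn_integral_mono simp: fin split: split_indicator)
  define F where "F i = {x::'b. to_nat x < i}" for i :: nat
  have finF: "finite (F i)" for i
    unfolding F_def using finite_vimageI[OF finite_lessThan[of i] inj_to_nat] by (simp add: vimage_def)
  have sup: "f x = (SUP i. f x * indicator (F i) x)" for x
    by (rule antisym)
      (auto intro!: SUP_upper2[of "Suc (to_nat x)"] SUP_least simp: F_def split: split_indicator)
  have "(\<integral>\<^sup>+x. f x \<partial>count_space A) = (\<integral>\<^sup>+x. (SUP i. f x * indicator (F i) x) \<partial>count_space A)"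
    using sup by simp
  also have "\<dots> = (SUP i. \<integral>\<^sup>+x. f x * indicator (F i) x \<partial>count_space A)"
    by (rule nn_integral_monotone_convergence_SUP)
      (auto simp: incseq_def le_fun_def F_def split: split_indicator)
  also have "\<dots> = (SUP i. sum f (F i \<inter> A))"
    by (subst fin) (auto intro!: SUP_cong nn_integral_cong simp: finF split: split_indicator)
  also have "\<dots> \<le> (\<Sum>\<^sub>\<infinity>x\<in>A. f x)"
    unfolding nonneg_infsum_complete[OF zero_le]
    by (rule SUP_least, rule SUP_upper) (auto simp: finF)
  finally show "(\<integral>\<^sup>+x. f x \<partial>count_space A) \<le> (\<Sum>\<^sub>\<infinity>x\<in>A. f x)" .
qed

text \<open>Tonelli for counting measures; it makes sums over concatenated words factor.\<close>

lemma nn_integral_count_space_times: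
  fixes f :: "'b::countable \<Rightarrow> ennreal" and g :: "'c::countable \<Rightarrow> ennreal"
  shows "(\<integral>\<^sup>+p. f (fst p) * g (snd p) \<partial>count_space (A \<times> B)) =
         (\<integral>\<^sup>+x. f x \<partial>count_space A) * (\<integral>\<^sup>+y. g y \<partial>count_space B)"
proof -
  have "(\<integral>\<^sup>+p. f (fst p) * g (snd p) \<partial>count_space (A \<times> B)) =
        (\<integral>\<^sup>+p. (f (fst p) * indicator A (fst p)) * (g (snd p) * indicator B (snd p)) \<partial>count_space UNIV)"
    by (subst nn_integral_count_space_indicator) (auto intro!: nn_integral_cong split: split_indicator)
  also have "\<dots> = (\<integral>\<^sup>+x. \<integral>\<^sup>+y. (f x * indicator A x) * (g y * indicator B y) \<partial>count_space UNIV \<partial>count_space UNIV)"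
    by (subst nn_integral_fst_count_space[symmetric]) simp
  also have "\<dots> = (\<integral>\<^sup>+x. f x * indicator A x \<partial>count_space UNIV) * (\<integral>\<^sup>+y. g y * indicator B y \<partial>count_space UNIV)"
    by (simp add: nn_integral_cmult nn_integral_multc)
  finally show ?thesis
    by (simp add: nn_integral_count_space_indicator)
qed

section \<open>Sets of Hausdorff measure zero\<close>

lemma hausdorff_measure_eq_0I:
  fixes A :: "'a::metric_space set"
  assumes "\<And>\<delta> \<epsilon>. 0 < \<delta> \<Longrightarrow> 0 < \<epsilon> \<Longrightarrow> \<exists>U::nat \<Rightarrow> 'a set. A \<subseteq> (\<Union>i. U i) \<and>
      (\<forall>i. bounded (U i) \<and> diameter (U i) \<le> \<delta>) \<and> (\<Sum>i. ennreal (hausdorff_weight s (U i))) \<le> ennreal \<epsilon>"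
  shows "hausdorff_measure s A = 0"
proof -
  have "hausdorff_premeasure s \<delta> A \<le> 0" if "0 < \<delta>" for \<delta>
  proof (rule ennreal_le_epsilon)
    fix \<epsilon> :: real assume "0 < \<epsilon>"
    then obtain U :: "nat \<Rightarrow> 'a set" where U: "A \<subseteq> (\<Union>i. U i)"
      "\<forall>i. bounded (U i) \<and> diameter (U i) \<le> \<delta>"
      "(\<Sum>i. ennreal (hausdorff_weight s (U i))) \<le> ennreal \<epsilon>"
      using assms[OF \<open>0 < \<delta>\<close> \<open>0 < \<epsilon>\<close>] by (elim exE conjE)
    have "hausdorff_premeasure s \<delta> A \<le> (\<Sum>i. ennreal (hausdorff_weight s (U i)))"
      unfolding hausdorff_premeasure_def using U by (intro INF_lower) auto
    with U(3) show "hausdorff_premeasure s \<delta> A \<le> 0 + ennreal \<epsilon>"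
      by simp
  qed
  then show ?thesis
    unfolding hausdorff_measure_def by (auto intro!: antisym SUP_least)
qed

text \<open>The premeasure at scale 1 suffices, since for positive \<open>s\<close> a small total
  weight by itself forces every diameter to be small.\<close>

lemma hausdorff_measure_eq_0D:
  fixes A :: "'a::metric_space set"
  assumes "hausdorff_measure s A = 0" and "0 < \<epsilon>"
  obtains U :: "nat \<Rightarrow> 'a set" where "A \<subseteq> (\<Union>i. U i)" "\<And>i. bounded (U i)"
    "(\<Sum>i. ennreal (hausdorff_weight s (U i))) < ennreal \<epsilon>"
proof -
  have "hausdorff_premeasure s 1 A \<le> hausdorff_measure s A"
    unfolding hausdorff_measure_def by (intro SUP_upper) auto
  then have "hausdorff_premeasure s 1 A < ennreal \<epsilon>"
    using assms by simp
  then show thesis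
    unfolding hausdorff_premeasure_def INF_less_iff by (elim bexE) (rule that, auto)
qed

text \<open>For exponent 0 every nonempty covering set weighs 1, so a cover of weight below 1
  consists of empty sets.\<close>

lemma hausdorff_measure_0_eq_0D:
  assumes "hausdorff_measure 0 A = 0"
  shows "A = {}"
proof -
  obtain U where U: "A \<subseteq> (\<Union>i. U i)" "(\<Sum>i. ennreal (hausdorff_weight 0 (U i))) < ennreal 1"
    by (rule hausdorff_measure_eq_0D[OF assms zero_less_one])
  have "U i = {}" for i
  proof (rule ccontr)
    assume "U i \<noteq> {}"
    then have "ennreal 1 = (\<Sum>j\<in>{i}. ennreal (hausdorff_weight 0 (U j)))"
      by (simp add: hausdorff_weight_def)
    also have "\<dots> \<le> (\<Sum>j. ennreal (hausdorff_weight 0 (U j)))"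
      by (intro sum_le_suminf) auto
    finally show False using U(2) by simp
  qed
  with U(1) show ?thesis by auto
qed

lemma hausdorff_measure_empty: "hausdorff_measure s {} = 0"
  by (rule hausdorff_measure_eq_0I) (auto intro!: exI[of _ "\<lambda>_. {}"] simp: hausdorff_weight_def)

section \<open>Intervals indexed by the words over a finite set\<close>

text \<open>
  If the words of the \<open>S i\<close> extending \<open>u\<close> have less mass than \<open>u\<close> itself, then the same holds for
  some child of \<open>u\<close>, so one can descend forever.
\<close>
lemma exists_path_avoiding_light_sets:
  fixes q :: "'b \<Rightarrow> real" and S :: "nat \<Rightarrow> 'b list set"
  assumes "finite W" and q: "\<And>w. w \<in> W \<Longrightarrow> 0 \<le> q w" "1 \<le> (\<Sum>w\<in>W. q w)"
    and S: "\<And>i. finite (S i)" "\<And>i. S i \<subseteq> lists W"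
    and light: "(\<Sum>i. ennreal (\<Sum>v\<in>S i. prod_list (map q v))) < 1"
  obtains x :: "nat \<Rightarrow> 'b" where "\<And>k. x k \<in> W" and "\<And>k i. map x [0..<k] \<notin> S i"
proof -
  define Q where "Q v = prod_list (map q v)" for v
  have Q_nonneg: "0 \<le> Q v" if "v \<in> lists W" for v
    using that unfolding Q_def by (induction v) (auto intro!: mult_nonneg_nonneg q)
  \<comment> \<open>\<open>T u\<close> is the mass of the forbidden words at or below the node
    \<open>u\<close>, counted once for every \<open>i\<close>. The invariant of the descent is that
    it falls short of the mass of \<open>u\<close>.\<close>
  define T where "T u = (\<Sum>i. ennreal (\<Sum>v\<in>{v \<in> S i. prefix u v}. Q v))" for u
  have step: "\<exists>w\<in>W. T (u @ [w]) < ennreal (Q (u @ [w]))" if u: "u \<in> lists W" "T u < ennreal (Q u)" for u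
  proof (rule ccontr)
    assume "\<not> ?thesis"
    then have ge: "ennreal (Q (u @ [w])) \<le> T (u @ [w])" if "w \<in> W" for w
      using that by (auto simp: not_less)
    have le: "(\<Sum>w\<in>W. \<Sum>v\<in>{v \<in> S i. prefix (u @ [w]) v}. Q v) \<le> (\<Sum>v\<in>{v \<in> S i. prefix u v}. Q v)" for i
    proof -
      have "(\<Sum>w\<in>W. \<Sum>v\<in>{v \<in> S i. prefix (u @ [w]) v}. Q v) = (\<Sum>v\<in>(\<Union>w\<in>W. {v \<in> S i. prefix (u @ [w]) v}). Q v)"
        using \<open>finite W\<close> S(1)
        by (intro sum.UNION_disjoint[symmetric]) (auto simp: prefix_def)
      also have "\<dots> \<le> (\<Sum>v\<in>{v \<in> S i. prefix u v}. Q v)"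
      proof (rule sum_mono2)
        show "0 \<le> Q v" if "v \<in> {v \<in> S i. prefix u v} - (\<Union>w\<in>W. {v \<in> S i. prefix (u @ [w]) v})" for v
          using that S(2) by (intro Q_nonneg) blast
      qed (use S(1) in \<open>auto intro: append_prefixD\<close>)
      finally show ?thesis .
    qed
    \<comment> \<open>As \<open>q\<close> has total at least 1, passing from \<open>u\<close> to its
      children loses no mass; if no child were light, \<open>u\<close> would not be light
      either.\<close>
    have "Q u \<le> Q u * (\<Sum>w\<in>W. q w)"
      using mult_left_mono[OF q(2) Q_nonneg[OF u(1)]] by simp
    also have "\<dots> = (\<Sum>w\<in>W. Q (u @ [w]))"
      by (simp add: Q_def sum_distrib_left)
    finally have "ennreal (Q u) \<le> ennreal (\<Sum>w\<in>W. Q (u @ [w]))"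
      by (rule ennreal_leI)
    also have "\<dots> = (\<Sum>w\<in>W. ennreal (Q (u @ [w])))"
      using u(1) by (intro sum_ennreal[symmetric] Q_nonneg) auto
    also have "\<dots> \<le> (\<Sum>w\<in>W. T (u @ [w]))"
      by (intro sum_mono ge)
    also have "\<dots> = (\<Sum>i. \<Sum>w\<in>W. ennreal (\<Sum>v\<in>{v \<in> S i. prefix (u @ [w]) v}. Q v))"
      unfolding T_def by (intro suminf_sum[symmetric]) auto
    also have "\<dots> = (\<Sum>i. ennreal (\<Sum>w\<in>W. \<Sum>v\<in>{v \<in> S i. prefix (u @ [w]) v}. Q v))"
      using S(2) by (intro suminf_cong sum_ennreal sum_nonneg Q_nonneg) auto
    also have "\<dots> \<le> T u"
      unfolding T_def by (intro suminf_le ennreal_leI le) auto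
    finally show False
      using u(2) by simp
  qed
  then obtain f where f: "\<And>u. u \<in> lists W \<Longrightarrow> T u < ennreal (Q u) \<Longrightarrow>
      f u \<in> W \<and> T (u @ [f u]) < ennreal (Q (u @ [f u]))"
    by metis
  define p where "p = rec_nat [] (\<lambda>_ u. u @ [f u])"
  have p_simps: "p 0 = []" "p (Suc k) = p k @ [f (p k)]" for k
    by (simp_all add: p_def)
  have "T [] < ennreal (Q [])"
    using light by (simp add: T_def Q_def)
  then have inv: "p k \<in> lists W \<and> T (p k) < ennreal (Q (p k))" for k
    by (induction k) (use f in \<open>auto simp: p_simps\<close>)
  have p_eq: "p k = map (\<lambda>j. f (p j)) [0..<k]" for k
    by (induction k) (simp_all add: p_simps)
  \<comment> \<open>A word of \<open>S i\<close> extends itself, so its own mass would already make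
    \<open>T (p k)\<close> at least \<open>Q (p k)\<close>.\<close>
  have "p k \<notin> S i" for k i
  proof
    assume "p k \<in> S i"
    then have "Q (p k) \<le> (\<Sum>v\<in>{v \<in> S i. prefix (p k) v}. Q v)"
      using S by (intro member_le_sum) (auto intro!: Q_nonneg dest!: subsetD[OF S(2)])
    then have "ennreal (Q (p k)) \<le> (\<Sum>j\<in>{i}. ennreal (\<Sum>v\<in>{v \<in> S j. prefix (p k) v}. Q v))"
      by (simp add: ennreal_leI)
    also have "\<dots> \<le> T (p k)"
      unfolding T_def by (intro sum_le_suminf) auto
    finally show False
      using inv[of k] leD by blast
  qed
  then show thesis
    using that[of "\<lambda>j. f (p j)"] f inv p_eq by metis
qed

section \<open>Trees of intervals and their stopping words\<close>

text \<open>Letters are abstract because they will themselves be words of one fixed length, a node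
  being a list of such words and the root \<open>[]\<close> the unit interval. The ratio
  \<open>c\<close> keeps the intervals that are cut off at a given scale comparable in length to
  that scale.\<close>

locale interval_tree =
  fixes W :: "'b set" and left len :: "'b list \<Rightarrow> real" and c :: real
  assumes finite_W: "finite W"
    and c_pos: "0 < c"
    and len_pos: "v \<in> lists W \<Longrightarrow> 0 < len v"
    and child_subset: "v \<in> lists W \<Longrightarrow> w \<in> W \<Longrightarrow>
      {left (v @ [w]) .. left (v @ [w]) + len (v @ [w])} \<subseteq> {left v .. left v + len v}"
    and children_disjoint: "v \<in> lists W \<Longrightarrow> w \<in> W \<Longrightarrow> w' \<in> W \<Longrightarrow> w \<noteq> w' \<Longrightarrow>
      {left (v @ [w]) .. left (v @ [w]) + len (v @ [w])} \<inter>
      {left (v @ [w']) .. left (v @ [w']) + len (v @ [w'])} = {}"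
    and len_child_ge: "v \<in> lists W \<Longrightarrow> w \<in> W \<Longrightarrow> c * len v \<le> len (v @ [w])"
begin

definition ival :: "'b list \<Rightarrow> real set" where
  "ival v = {left v .. left v + len v}"

text \<open>A Moran cut-set: along each branch, the first node of length at most \<open>l\<close>,
  kept only if its interval meets \<open>U\<close>. The root has no parent to compare with and is
  left out.\<close>

definition stops :: "real \<Rightarrow> real set \<Rightarrow> 'b list set" where
  "stops l U = {v \<in> lists W. v \<noteq> [] \<and> len v \<le> l \<and> l < len (butlast v) \<and> ival v \<inter> U \<noteq> {}}"

lemma ival_append_subset: "u @ v \<in> lists W \<Longrightarrow> ival (u @ v) \<subseteq> ival u"
proof (induction v rule: rev_induct)
  case (snoc w v)
  then have uv: "u @ v \<in> lists W" "w \<in> W"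
    by auto
  have "ival ((u @ v) @ [w]) \<subseteq> ival (u @ v)"
    unfolding ival_def by (rule child_subset[OF uv])
  with snoc.IH[OF uv(1)] show ?case
    by (metis append_assoc subset_trans)
qed simp

text \<open>The two intervals lie in distinct children of the longest common prefix.\<close>

lemma ival_disjoint:
  assumes "u \<in> lists W" "v \<in> lists W" "u \<parallel> v"
  shows "ival u \<inter> ival v = {}"
proof -
  obtain p a as b bs where eq: "a \<noteq> b" "u = p @ a # as" "v = p @ b # bs"
    using parallel_decomp[OF assms(3)] by blast
  have "ival u \<subseteq> ival (p @ [a])" "ival v \<subseteq> ival (p @ [b])"
    using ival_append_subset[of "p @ [a]" as] ival_append_subset[of "p @ [b]" bs] assms eq by auto
  moreover have "ival (p @ [a]) \<inter> ival (p @ [b]) = {}"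
    unfolding ival_def using assms eq by (intro children_disjoint) auto
  ultimately show ?thesis by blast
qed

lemma len_append_le: "u @ v \<in> lists W \<Longrightarrow> len (u @ v) \<le> len u"
  using ival_append_subset[of u v] len_pos[of "u @ v"] by (auto simp: ival_def)

text \<open>A proper prefix \<open>u\<close> of \<open>v\<close> is also a prefix of the parent of
  \<open>v\<close>, whose length would then be at most \<open>len u \<le> l\<close>, against the
  choice of \<open>v\<close> as the first short node.\<close>

lemma stops_parallel:
  assumes "u \<in> stops l U" "v \<in> stops l U" "u \<noteq> v"
  shows "u \<parallel> v"
proof -
  have no_prefix: "\<not> prefix u v" if "u \<in> stops l U" "v \<in> stops l U" "u \<noteq> v" for u v
  proof
    assume "prefix u v"
    moreover have "v = butlast v @ [last v]"
      using that by (auto simp: stops_def)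
    ultimately have "prefix u (butlast v)"
      using \<open>u \<noteq> v\<close> by (metis prefix_snoc)
    then obtain z where "butlast v = u @ z"
      by (auto elim: prefixE)
    moreover have "butlast v \<in> lists W"
      using that by (auto simp: stops_def dest: in_set_butlastD)
    ultimately have "len (butlast v) \<le> len u"
      using len_append_le[of u z] by simp
    then show False
      using that by (auto simp: stops_def)
  qed
  show ?thesis
    using no_prefix assms by blast
qed

text \<open>
  The intervals indexed by \<open>stops l U\<close> are disjoint, have length at least \<open>c * l\<close>, and lie within
  distance \<open>2 * l\<close> of any point of \<open>U\<close>: this is where the geometry of the line enters.
\<close>
lemma card_stops:
  assumes l: "0 < l" and U: "bounded U" "diameter U \<le> l"
  shows "finite (stops l U)" and "card (stops l U) \<le> 4 / c"
proof -
  \<comment> \<open>Finite subsets are counted first; the uniform bound on them then yields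
    finiteness of \<open>stops l U\<close> itself.\<close>
  have bound: "card F \<le> 4 / c" if F: "F \<subseteq> stops l U" "finite F" for F
  proof (cases "F = {}")
    case True
    then show ?thesis using c_pos by simp
  next
    case False
    then obtain x where x: "x \<in> U"
      using F(1) by (auto simp: stops_def)
    have near: "\<bar>y - x\<bar> \<le> l" if "y \<in> U" for y
      using diameter_bounded_bound[OF U(1) that x] U(2) by (simp add: dist_real_def)
    have "card F * (c * l) = (\<Sum>v\<in>F. c * l)"
      by simp
    also have "\<dots> \<le> (\<Sum>v\<in>F. len v)"
    proof (intro sum_mono)
      fix v assume "v \<in> F"
      with F(1) have v: "v \<in> lists W" "v \<noteq> []" "l < len (butlast v)"
        by (auto simp: stops_def)
      then have "butlast v \<in> lists W" "last v \<in> W"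
        by (auto dest: in_set_butlastD)
      then have "c * len (butlast v) \<le> len v"
        using len_child_ge[of "butlast v" "last v"] v by simp
      moreover have "c * l \<le> c * len (butlast v)"
        using v c_pos by simp
      ultimately show "c * l \<le> len v"
        by linarith
    qed
    also have "\<dots> \<le> (x + 2 * l) - (x - 2 * l)"
    proof (rule sum_length_disjoint_intervals_le[where x = left])
      show "{left v .. left v + len v} \<subseteq> {x - 2 * l .. x + 2 * l}" if v: "v \<in> F" for v
      proof -
        have "ival v \<inter> U \<noteq> {}" "len v \<le> l"
          using v F(1) by (auto simp: stops_def)
        then obtain y where "y \<in> U" "left v \<le> y" "y \<le> left v + len v" "len v \<le> l"
          by (auto simp: ival_def)
        then show ?thesis
          using near[of y] by auto
      qed
      show "{left u .. left u + len u} \<inter> {left v .. left v + len v} = {}"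
        if "u \<in> F" "v \<in> F" "u \<noteq> v" for u v
        using ival_disjoint[OF _ _ stops_parallel[of u l U v]] that F(1)
        unfolding ival_def by (auto simp: stops_def)
      show "0 \<le> len v" if "v \<in> F" for v
        using len_pos[of v] that F(1) unfolding stops_def by fastforce
    qed (use F l in auto)
    finally have "(card F * c) * l \<le> 4 * l"
      by (simp add: algebra_simps)
    then show ?thesis
      using l c_pos by (simp add: field_simps)
  qed
  have "card F \<le> nat \<lfloor>4 / c\<rfloor>" if "F \<subseteq> stops l U" "finite F" for F
    using bound[OF that] by (simp add: le_nat_floor)
  then show fin: "finite (stops l U)"
    using finite_if_finite_subsets_card_bdd by blast
  show "card (stops l U) \<le> 4 / c"
    using bound fin by blast
qed

text \<open>The stopping word is the first initial segment of the path whose length is at most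
  \<open>l\<close>; \<open>l < len []\<close> ensures that it has a parent.\<close>

lemma path_meets_stops:
  assumes x: "\<And>k. x k \<in> W"
    and lim: "(\<lambda>k. len (map x [0..<k])) \<longlonglongrightarrow> 0"
    and z: "\<And>k. z \<in> ival (map x [0..<k])" "z \<in> U"
    and l: "0 < l" "l < len []"
  shows "\<exists>k. map x [0..<k] \<in> stops l U"
proof -
  have ex: "\<exists>k. len (map x [0..<k]) \<le> l"
    using order_tendstoD(2)[OF lim l(1)] by (auto simp: eventually_sequentially intro: less_imp_le)
  define k where "k = (LEAST k. len (map x [0..<k]) \<le> l)"
  have k: "len (map x [0..<k]) \<le> l"
    using LeastI_ex[OF ex] by (simp add: k_def)
  then have "k \<noteq> 0"
    using l by (intro notI) simp
  then obtain m where m: "k = Suc m"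
    by (cases k) auto
  have "\<not> len (map x [0..<m]) \<le> l"
    using not_less_Least[of m "\<lambda>k. len (map x [0..<k]) \<le> l"] m by (simp add: k_def)
  moreover have "z \<in> ival (map x [0..<k]) \<inter> U"
    using z by blast
  ultimately have "map x [0..<k] \<in> stops l U"
    using k x unfolding stops_def m by (auto simp: lists_eq_set)
  then show ?thesis ..
qed

lemma path_limit:
  assumes x: "\<And>k. x k \<in> W"
  obtains z where "\<And>k. z \<in> ival (map x [0..<k])"
proof -
  have "(\<Inter>k. ival (map x [0..<k])) \<noteq> {}"
  proof (rule compact_nest)
    fix m n :: nat assume "m \<le> n"
    then have "map x [0..<n] = map x [0..<m] @ map x [m..<n]"
      by (metis le_add_diff_inverse map_append upt_add_eq_append zero_le)
    then show "ival (map x [0..<n]) \<subseteq> ival (map x [0..<m])"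
      using ival_append_subset[of "map x [0..<m]" "map x [m..<n]"] x by (auto simp: lists_eq_set)
  next
    fix n
    have "map x [0..<n] \<in> lists W"
      using x by (auto simp: lists_eq_set)
    then show "ival (map x [0..<n]) \<noteq> {}"
      using len_pos[of "map x [0..<n]"] by (simp add: ival_def)
  qed (simp add: ival_def)
  then show thesis
    using that by blast
qed

section \<open>Positivity of Hausdorff measure\<close>

text \<open>Takes the place of the mass distribution principle without constructing a measure:
  \<open>prod_list (map q v)\<close> serves as the mass of the node \<open>v\<close>, although the
  children together may carry more than their parent.\<close>

lemma hausdorff_measure_pos:
  assumes s: "0 < s"
    and q: "\<And>w. w \<in> W \<Longrightarrow> 0 \<le> q w" "1 \<le> (\<Sum>w\<in>W. q w)"
    and q_le: "\<And>v. v \<in> lists W \<Longrightarrow> prod_list (map q v) \<le> len v powr s"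
    and A: "\<And>x z. (\<And>k. x k \<in> W) \<Longrightarrow> (\<And>k. z \<in> ival (map x [0..<k])) \<Longrightarrow> z \<in> A"
    and lim: "\<And>x. (\<And>k. x k \<in> W) \<Longrightarrow> (\<lambda>k. len (map x [0..<k])) \<longlonglongrightarrow> 0"
  shows "hausdorff_measure s A \<noteq> 0"
proof
  assume zero: "hausdorff_measure s A = 0"
  \<comment> \<open>The bound \<open>c / 16\<close> makes the final mass
    \<open>8 * \<epsilon> / c\<close> at most one half; \<open>len [] powr s / 4\<close> keeps the
    enlarged diameters below the length of the root.\<close>
  define \<epsilon> where "\<epsilon> = min (c / 16) (len [] powr s / 4)"
  have root: "0 < len []"
    using len_pos by simp
  then have \<epsilon>: "0 < \<epsilon>" "8 * \<epsilon> / c < 1" "2 * \<epsilon> < len [] powr s"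
    using c_pos by (auto simp: \<epsilon>_def min_def field_simps)
  obtain U where U: "A \<subseteq> (\<Union>i. U i)" "\<And>i. bounded (U i)"
    and sumU: "(\<Sum>i. ennreal (hausdorff_weight s (U i))) < ennreal \<epsilon>"
    by (rule hausdorff_measure_eq_0D[OF zero \<epsilon>(1)]) (rule that)
  define d where "d i = diameter (U i)" for i
  have d0: "0 \<le> d i" for i
    unfolding d_def by (rule diameter_ge_0[OF U(2)])
  have weight: "hausdorff_weight s (U i) = d i powr s" for i
    using s by (simp add: hausdorff_weight_def d_def)
  have d_le: "d i powr s \<le> \<epsilon>" for i
  proof -
    have "(\<Sum>j\<in>{i}. ennreal (d j powr s)) \<le> (\<Sum>j. ennreal (d j powr s))"
      by (intro sum_le_suminf) auto
    also have "\<dots> < ennreal \<epsilon>"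
      using sumU by (simp add: weight)
    finally show ?thesis
      using \<epsilon>(1) by (simp add: ennreal_less_iff)
  qed
  text \<open>Enlarged diameters, since those of singletons vanish.\<close>
  define h where "h i = d i powr s + \<epsilon> * (1 / 2) ^ Suc i" for i
  define l where "l i = h i powr (1 / s)" for i
  have h_pos: "0 < h i" for i
    unfolding h_def using \<epsilon>(1) by (intro add_nonneg_pos) auto
  have l_pos: "0 < l i" for i
    unfolding l_def using h_pos[of i] by simp
  have l_powr: "l i powr s = h i" for i
    using s h_pos[of i] by (simp add: l_def powr_powr)
  have l_ge: "d i \<le> l i" for i
  proof (rule ccontr)
    assume "\<not> d i \<le> l i"
    then have "l i powr s < d i powr s"
      using l_pos[of i] s by (intro powr_less_mono2) auto
    moreover have "0 \<le> \<epsilon> * (1 / 2) ^ Suc i"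
      using \<epsilon>(1) by simp
    ultimately show False
      unfolding l_powr h_def by linarith
  qed
  have l_less: "l i < len []" for i
  proof (rule ccontr)
    assume "\<not> l i < len []"
    then have "len [] powr s \<le> l i powr s"
      using root s by (intro powr_mono2) auto
    moreover have "(1 / 2 :: real) ^ Suc i \<le> 1"
      by (rule power_le_one) auto
    then have "\<epsilon> * (1 / 2) ^ Suc i \<le> \<epsilon>"
      using \<epsilon>(1) by (simp only: mult_left_le less_imp_le)
    then have "h i \<le> 2 * \<epsilon>"
      using d_le[of i] unfolding h_def by linarith
    ultimately show False
      using \<epsilon>(3) by (simp add: l_powr)
  qed
  \<comment> \<open>The scale \<open>l i\<close> is at least the diameter of \<open>U i\<close>, as
    \<open>card_stops\<close> requires, and below the root length, as
    \<open>path_meets_stops\<close> requires.\<close>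
  define S where "S i = stops (l i) (U i)" for i
  have finS: "finite (S i)" and cardS: "card (S i) \<le> 4 / c" for i
    unfolding S_def using card_stops[OF l_pos U(2), of i i] l_ge[of i] by (auto simp: d_def)
  have mass: "(\<Sum>v\<in>S i. prod_list (map q v)) \<le> 4 / c * h i" for i
  proof -
    have "(\<Sum>v\<in>S i. prod_list (map q v)) \<le> (\<Sum>v\<in>S i. h i)"
    proof (rule sum_mono)
      fix v assume "v \<in> S i"
      then have v: "v \<in> lists W" "len v \<le> l i"
        by (auto simp: S_def stops_def)
      then have "len v powr s \<le> l i powr s"
        using s len_pos[of v] by (intro powr_mono2) auto
      then show "prod_list (map q v) \<le> h i"
        using q_le[OF v(1)] by (simp add: l_powr)
    qed
    also have "\<dots> = card (S i) * h i"
      by simp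
    also have "\<dots> \<le> 4 / c * h i"
      using cardS h_pos[of i] by (intro mult_right_mono) auto
    finally show ?thesis .
  qed
  have "(\<lambda>i. \<epsilon> * (1 / 2) ^ Suc i) sums \<epsilon>"
    using sums_mult[OF power_half_series, of \<epsilon>] by simp
  then have geo: "(\<Sum>i. ennreal (\<epsilon> * (1 / 2) ^ Suc i)) = ennreal \<epsilon>"
    using \<epsilon>(1) by (intro suminf_ennreal_eq) auto
  have "(\<Sum>i. ennreal (\<Sum>v\<in>S i. prod_list (map q v))) \<le> (\<Sum>i. ennreal (4 / c * h i))"
    by (intro suminf_le ennreal_leI mass) auto
  also have "\<dots> = ennreal (4 / c) * (\<Sum>i. ennreal (h i))"
    unfolding ennreal_suminf_cmult[symmetric]
    using c_pos h_pos by (intro suminf_cong ennreal_mult) (auto intro: less_imp_le)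
  also have "(\<Sum>i. ennreal (h i)) = (\<Sum>i. ennreal (d i powr s)) + (\<Sum>i. ennreal (\<epsilon> * (1 / 2) ^ Suc i))"
    unfolding h_def using \<epsilon>(1) by (subst suminf_add) (auto intro!: suminf_cong ennreal_plus)
  also have "\<dots> \<le> ennreal \<epsilon> + ennreal \<epsilon>"
    unfolding geo using sumU by (intro add_mono) (auto simp: weight less_imp_le)
  also have "ennreal (4 / c) * (ennreal \<epsilon> + ennreal \<epsilon>) = ennreal (8 * \<epsilon> / c)"
    using c_pos \<epsilon>(1) by (simp flip: ennreal_plus ennreal_mult)
  also have "\<dots> < 1"
    using \<epsilon>(2) c_pos \<epsilon>(1) by (simp add: ennreal_less_one_iff)
  finally have light: "(\<Sum>i. ennreal (\<Sum>v\<in>S i. prod_list (map q v))) < 1"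
    by (simp add: mult_left_mono)
  obtain x where x: "\<And>k. x k \<in> W" "\<And>k i. map x [0..<k] \<notin> S i"
    by (rule exists_path_avoiding_light_sets[OF finite_W q finS _ light]) (auto simp: S_def stops_def)
  obtain z where z: "\<And>k. z \<in> ival (map x [0..<k])"
    by (rule path_limit[of x, OF x(1)]) (rule that)
  then obtain i where "z \<in> U i"
    using A[of x z] x(1) U(1) by blast
  then show False
    using path_meets_stops[of x, OF x(1) lim[of x, OF x(1)] z _ l_pos l_less] x(2)
    unfolding S_def by blast
qed

end

section \<open>Constructions with quasi-multiplicative lengths\<close>

lemma funpow_full_shift: "(full_shift ^^ n) x = (\<lambda>i. x (i + n))"
  by (induction n) (simp_all add: full_shift_def)

text \<open>Such a point repeats its first \<open>Suc m\<close> symbols forever; the first of them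
  is \<open>a\<close>, so the remaining \<open>m\<close> are free.\<close>

lemma bij_betw_periodic_points:
  "bij_betw (\<lambda>v i. (a # v) ! (i mod Suc m)) {v. length v = m}
     {x. (full_shift ^^ Suc m) x = x \<and> x 0 = a}"
proof (rule bij_betw_byWitness[where f' = "\<lambda>x. map x [1..<Suc m]"])
  show "\<forall>v\<in>{v. length v = m}. map (\<lambda>i. (a # v) ! (i mod Suc m)) [1..<Suc m] = v"
  proof
    fix v :: "nat list" assume "v \<in> {v. length v = m}"
    then show "map (\<lambda>i. (a # v) ! (i mod Suc m)) [1..<Suc m] = v"
      by (intro nth_equalityI) (simp_all del: upt_Suc)
  qed
  show "\<forall>x\<in>{x. (full_shift ^^ Suc m) x = x \<and> x 0 = a}.
      (\<lambda>i. (a # map x [1..<Suc m]) ! (i mod Suc m)) = x"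
  proof (intro ballI ext)
    fix x i assume "x \<in> {x. (full_shift ^^ Suc m) x = x \<and> x 0 = a}"
    then have "(full_shift ^^ Suc m) x = x" "x 0 = a"
      by blast+
    then have per: "x (i + Suc m) = x i" for i
      unfolding funpow_full_shift by (auto dest: fun_cong)
    have mult: "x (j + k * Suc m) = x j" for j k
    proof (induction k)
      case (Suc k)
      then show ?case
        using per[of "j + k * Suc m"] by (simp add: algebra_simps)
    qed simp
    have "a # map x [1..<Suc m] = map x [0..<Suc m]"
      using \<open>x 0 = a\<close> by (simp add: upt_conv_Cons del: upt_Suc)
    then have "(a # map x [1..<Suc m]) ! (i mod Suc m) = x (i mod Suc m)"
      by (simp del: upt_Suc)
    also have "\<dots> = x i"
      using mult[of "i mod Suc m" "i div Suc m"] by (metis mod_mult_div_eq mult.commute)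
    finally show "(a # map x [1..<Suc m]) ! (i mod Suc m) = x i" .
  qed
  show "(\<lambda>v i. (a # v) ! (i mod Suc m)) ` {v. length v = m} \<subseteq> {x. (full_shift ^^ Suc m) x = x \<and> x 0 = a}"
    by (auto simp: funpow_full_shift simp del: funpow.simps add_Suc_right)
qed auto

locale quasi_multiplicative_construction = geometric_construction +
  fixes C :: real and \<phi> :: "nat \<Rightarrow> (nat \<Rightarrow> nat) \<Rightarrow> real"
  assumes C_pos: "0 < C"
    and quasi_mult: "u \<noteq> [] \<Longrightarrow> v \<noteq> [] \<Longrightarrow> r u * r v * exp (- C) \<le> r (u @ v) \<and> r (u @ v) \<le> r u * r v * exp C"
    and potential: "w \<noteq> [] \<Longrightarrow> x \<in> cylinder w \<Longrightarrow> \<phi> (length w) x = ln (r w)"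
begin

section \<open>Nesting, disjointness and decay of the intervals\<close>

definition left :: "nat list \<Rightarrow> real" where
  "left w = (SOME b. \<Delta> w = {b .. b + r w})"

lemma \<Delta>_eq: "w \<noteq> [] \<Longrightarrow> \<Delta> w = {left w .. left w + r w}"
  unfolding left_def by (rule someI_ex) (rule closed_interval)

lemma \<Delta>_append_subset: "u \<noteq> [] \<Longrightarrow> \<Delta> (u @ v) \<subseteq> \<Delta> u"
proof (induction v rule: rev_induct)
  case (snoc m v)
  then show ?case
    using nested[of "u @ v" m] by auto
qed simp

lemma \<Delta>_unit: "w \<noteq> [] \<Longrightarrow> \<Delta> w \<subseteq> {0..1}"
  using \<Delta>_append_subset[of "[hd w]" "tl w"] in_unit_interval[of "hd w"] by simp

text \<open>The words branch after a common prefix \<open>p\<close>, possibly empty, in which case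
  the disjoint siblings are first-level intervals.\<close>

lemma \<Delta>_disjoint:
  assumes "u \<parallel> v"
  shows "\<Delta> u \<inter> \<Delta> v = {}"
proof -
  obtain p a as b bs where eq: "a \<noteq> b" "u = p @ a # as" "v = p @ b # bs"
    using parallel_decomp[OF assms] by blast
  then show ?thesis
    using \<Delta>_append_subset[of "p @ [a]" as] \<Delta>_append_subset[of "p @ [b]" bs] siblings_disjoint[of a b p]
    by auto
qed

lemma r_le_1: "w \<noteq> [] \<Longrightarrow> r w \<le> 1"
  using \<Delta>_unit[of w] \<Delta>_eq[of w] length_pos[of w] by auto

text \<open>Every child leaves room for a disjoint sibling of fixed proportion, so it is shorter
  than its parent by a fixed factor. The exponent is \<open>length w - 1\<close> since at the first
  level only \<open>r w \<le> 1\<close> is available.\<close>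

lemma exponential_decay:
  obtains \<theta> where "0 < \<theta>" "\<theta> < 1" "\<And>w. w \<noteq> [] \<Longrightarrow> r w \<le> \<theta> ^ (length w - 1)"
proof -
  \<comment> \<open>By quasi-multiplicativity the children 0 and 1 of any interval each have at
    least the proportion \<open>\<rho>\<close> of its length, and one of them differs from a given
    child \<open>j\<close>.\<close>
  define \<rho> where "\<rho> = exp (- C) * min (r [0]) (r [1])"
  have \<rho>: "0 < \<rho>" "\<rho> < 1"
  proof -
    show "0 < \<rho>"
      by (simp add: \<rho>_def length_pos)
    have "\<rho> \<le> exp (- C) * 1"
      unfolding \<rho>_def using r_le_1[of "[0]"] by (intro mult_left_mono) auto
    then show "\<rho> < 1"
      using C_pos by (smt (verit) exp_less_one_iff mult.right_neutral)
  qed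
  have child: "r (w @ [j]) \<le> (1 - \<rho>) * r w" if w: "w \<noteq> []" for w j
  proof -
    define i :: nat where "i = (if j = 0 then 1 else 0)"
    have "i \<noteq> j" by (simp add: i_def)
    have sub: "\<Delta> (w @ [k]) \<subseteq> \<Delta> w" for k
      using nested[OF w] .
    have "(\<Sum>k\<in>{i, j}. r (w @ [k])) \<le> (left w + r w) - left w"
    proof (rule sum_length_disjoint_intervals_le[where x = "\<lambda>k. left (w @ [k])"])
      show "{left (w @ [k]) .. left (w @ [k]) + r (w @ [k])} \<subseteq> {left w .. left w + r w}" for k
        using sub[of k] w unfolding \<Delta>_eq[OF w] by (subst \<Delta>_eq[symmetric]) auto
      show "{left (w @ [k]) .. left (w @ [k]) + r (w @ [k])} \<inter> {left (w @ [l]) .. left (w @ [l]) + r (w @ [l])} = {}"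
        if "k \<noteq> l" for k l
        using siblings_disjoint[OF that, of w] \<Delta>_eq[of "w @ [k]"] \<Delta>_eq[of "w @ [l]"]
        by (metis snoc_eq_iff_butlast)
    qed (use length_pos w in \<open>auto intro: less_imp_le\<close>)
    then have "r (w @ [i]) + r (w @ [j]) \<le> r w"
      using \<open>i \<noteq> j\<close> by simp
    moreover have "r w * \<rho> \<le> r w * r [i] * exp (- C)"
      using length_pos[OF w] by (auto simp: \<rho>_def i_def)
    moreover have "r w * r [i] * exp (- C) \<le> r (w @ [i])"
      using quasi_mult[OF w, of "[i]"] by simp
    ultimately show ?thesis
      by (simp add: algebra_simps)
  qed
  have "r (i # v) \<le> (1 - \<rho>) ^ length v" for i v
  proof (induction v rule: rev_induct)
    case Nil
    then show ?case using r_le_1 by simp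
  next
    case (snoc j v)
    have "r (i # v @ [j]) \<le> (1 - \<rho>) * r (i # v)"
      using child[of "i # v" j] by simp
    also have "\<dots> \<le> (1 - \<rho>) * (1 - \<rho>) ^ length v"
      using snoc \<rho> by (intro mult_left_mono) auto
    finally show ?case by simp
  qed
  then have "r w \<le> (1 - \<rho>) ^ (length w - 1)" if "w \<noteq> []" for w
    using that by (cases w) auto
  with that[of "1 - \<rho>"] \<rho> show thesis by auto
qed

text \<open>In logarithms quasi-multiplicativity is the symmetric bound \<open>C\<close> on a
  difference; multiplication by \<open>t\<close> turns it into \<open>\<bar>t\<bar> * C\<close> for
  either sign of \<open>t\<close>.\<close>

lemma powr_append_bounds:
  assumes "u \<noteq> []" "v \<noteq> []"
  shows "exp (- (\<bar>t\<bar> * C)) * (r u powr t * r v powr t) \<le> r (u @ v) powr t"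
    and "r (u @ v) powr t \<le> exp (\<bar>t\<bar> * C) * (r u powr t * r v powr t)"
proof -
  note pos = length_pos[OF assms(1)] length_pos[OF assms(2)] length_pos[of "u @ v"]
  have "ln (r u * r v * exp (- C)) \<le> ln (r (u @ v))"
    using quasi_mult[OF assms] pos assms by (subst ln_le_cancel_iff) auto
  moreover have "ln (r (u @ v)) \<le> ln (r u * r v * exp C)"
    using quasi_mult[OF assms] pos assms by (subst ln_le_cancel_iff) auto
  ultimately have "\<bar>ln (r (u @ v)) - ln (r u) - ln (r v)\<bar> \<le> C"
    using pos by (simp add: ln_mult)
  then have "\<bar>t * (ln (r (u @ v)) - ln (r u) - ln (r v))\<bar> \<le> \<bar>t\<bar> * C"
    unfolding abs_mult by (intro mult_left_mono) auto
  then have le: "- (\<bar>t\<bar> * C) + (t * ln (r u) + t * ln (r v)) \<le> t * ln (r (u @ v))"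
    "t * ln (r (u @ v)) \<le> \<bar>t\<bar> * C + (t * ln (r u) + t * ln (r v))"
    by (auto simp: algebra_simps)
  have eq: "r u powr t = exp (t * ln (r u))" "r v powr t = exp (t * ln (r v))"
    "r (u @ v) powr t = exp (t * ln (r (u @ v)))"
    using pos assms by (auto simp: powr_def)
  show "exp (- (\<bar>t\<bar> * C)) * (r u powr t * r v powr t) \<le> r (u @ v) powr t"
    unfolding eq exp_add[symmetric] using le by simp
  show "r (u @ v) powr t \<le> exp (\<bar>t\<bar> * C) * (r u powr t * r v powr t)"
    unfolding eq exp_add[symmetric] using le by simp
qed

section \<open>Partition sums over words of a given length\<close>

definition Z :: "real \<Rightarrow> nat \<Rightarrow> ennreal" where
  "Z t n = (\<integral>\<^sup>+w. ennreal (r w powr t) \<partial>count_space {w. length w = n})"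

text \<open>Cutting each word after \<open>n\<close> letters identifies long words with pairs, over
  which the sum of the products factors.\<close>

lemma Z_add_bounds:
  assumes "1 \<le> n" "1 \<le> m"
  shows "ennreal (exp (- (\<bar>t\<bar> * C))) * (Z t n * Z t m) \<le> Z t (n + m)"
    and "Z t (n + m) \<le> ennreal (exp (\<bar>t\<bar> * C)) * (Z t n * Z t m)"
proof -
  let ?A = "{w :: nat list. length w = n}" and ?B = "{w :: nat list. length w = m}"
  have "bij_betw (\<lambda>p. fst p @ snd p) (?A \<times> ?B) {w. length w = n + m}"
    by (rule bij_betw_byWitness[where f' = "\<lambda>w. (take n w, drop n w)"]) auto
  then have eq: "Z t (n + m) = (\<integral>\<^sup>+p. ennreal (r (fst p @ snd p) powr t) \<partial>count_space (?A \<times> ?B))"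
    unfolding Z_def by (rule nn_integral_bij_count_space[symmetric])
  have prod: "ennreal e * (Z t n * Z t m) =
      (\<integral>\<^sup>+p. ennreal (e * (r (fst p) powr t * r (snd p) powr t)) \<partial>count_space (?A \<times> ?B))" if "0 \<le> e" for e
    unfolding Z_def nn_integral_count_space_times[symmetric]
    using that by (subst nn_integral_cmult[symmetric]) (auto simp: ennreal_mult)
  have ne: "fst p \<noteq> []" "snd p \<noteq> []" if "p \<in> ?A \<times> ?B" for p
    using that assms by auto
  show "ennreal (exp (- (\<bar>t\<bar> * C))) * (Z t n * Z t m) \<le> Z t (n + m)"
    unfolding eq prod[OF exp_ge_zero]
    by (intro nn_integral_mono ennreal_leI powr_append_bounds ne) simp_all
  show "Z t (n + m) \<le> ennreal (exp (\<bar>t\<bar> * C)) * (Z t n * Z t m)"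
    unfolding eq prod[OF exp_ge_zero]
    by (intro nn_integral_mono ennreal_leI powr_append_bounds ne) simp_all
qed

text \<open>The Gurevich partition sum for period \<open>Suc n\<close>, by
  \<open>partition_sum_eq\<close>: the index counts only the letters after \<open>a\<close>.\<close>

definition Zfrom :: "nat \<Rightarrow> real \<Rightarrow> nat \<Rightarrow> ennreal" where
  "Zfrom a t n = (\<integral>\<^sup>+v. ennreal (r (a # v) powr t) \<partial>count_space {v. length v = n})"

text \<open>Prefixing \<open>a\<close> costs a factor depending only on \<open>a\<close> and
  \<open>t\<close>, which disappears from the growth rate. This is why the pressure is independent
  of \<open>a\<close>.\<close>

lemma Zfrom_bounds:
  assumes "1 \<le> n"
  shows "ennreal (exp (- (\<bar>t\<bar> * C)) * r [a] powr t) * Z t n \<le> Zfrom a t n"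
    and "Zfrom a t n \<le> ennreal (exp (\<bar>t\<bar> * C) * r [a] powr t) * Z t n"
proof -
  let ?A = "{w :: nat list. length w = n}"
  have prod: "ennreal (e * r [a] powr t) * Z t n =
      (\<integral>\<^sup>+v. ennreal (e * (r [a] powr t * r v powr t)) \<partial>count_space ?A)" if "0 \<le> e" for e
    unfolding Z_def using that by (subst nn_integral_cmult[symmetric]) (auto simp: ennreal_mult mult.assoc)
  have le: "exp (- (\<bar>t\<bar> * C)) * (r [a] powr t * r v powr t) \<le> r (a # v) powr t"
    "r (a # v) powr t \<le> exp (\<bar>t\<bar> * C) * (r [a] powr t * r v powr t)" if "v \<in> ?A" for v
    using powr_append_bounds[of "[a]" v t] that assms by (cases "v = []"; simp)+
  show "ennreal (exp (- (\<bar>t\<bar> * C)) * r [a] powr t) * Z t n \<le> Zfrom a t n"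
    unfolding Zfrom_def prod[OF exp_ge_zero]
    by (intro nn_integral_mono ennreal_leI le) simp
  show "Zfrom a t n \<le> ennreal (exp (\<bar>t\<bar> * C) * r [a] powr t) * Z t n"
    unfolding Zfrom_def prod[OF exp_ge_zero]
    by (intro nn_integral_mono ennreal_leI le) simp
qed

lemma Z_pos: "1 \<le> n \<Longrightarrow> 0 < Z t n"
proof -
  assume "1 \<le> n"
  then have "0 < ennreal (r (replicate n 0) powr t)"
    using length_pos[of "replicate n 0"] by auto
  also have "\<dots> \<le> Z t n"
    unfolding Z_def by (rule nn_integral_ge_point) simp
  finally show ?thesis .
qed

text \<open>Reduces finiteness at every level to the first one. The upper product bound propagates
  it upwards; for the converse the positive factor \<open>Z t n\<close> is cancelled in the lower
  bound.\<close>

lemma Z_finite_iff: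
  assumes "1 \<le> n"
  shows "Z t n < \<infinity> \<longleftrightarrow> Z t 1 < \<infinity>"
  using assms
proof (induction n rule: dec_induct)
  case (step n)
  have "Z t (Suc n) < \<infinity>" if "Z t 1 < \<infinity>"
  proof -
    have "Z t (n + 1) \<le> ennreal (exp (\<bar>t\<bar> * C)) * (Z t n * Z t 1)"
      using step by (intro Z_add_bounds) auto
    also have "\<dots> < \<infinity>"
      using step that by (auto simp: ennreal_mult_less_top)
    finally show ?thesis by simp
  qed
  moreover have "Z t 1 < \<infinity>" if "Z t (Suc n) < \<infinity>"
  proof -
    have "ennreal (exp (- (\<bar>t\<bar> * C))) * (Z t n * Z t 1) \<le> Z t (n + 1)"
      using step by (intro Z_add_bounds) auto
    also have "\<dots> < \<infinity>"
      using that by simp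
    finally show ?thesis
      using Z_pos[of n t] Z_pos[of 1 t] step by (auto simp: ennreal_mult_less_top)
  qed
  ultimately show ?case by blast
qed simp

section \<open>The pressure as growth rate of the partition sums\<close>

lemma partition_sum_eq:
  "(\<Sum>\<^sub>\<infinity>x \<in> {x. (full_shift ^^ Suc m) x = x}.
      ennreal (exp (t * \<phi> (Suc m) x) * indicator (cylinder [a]) x)) = Zfrom a t m"
proof -
  let ?g = "\<lambda>v i. (a # v) ! (i mod Suc m)"
  let ?P = "{x. (full_shift ^^ Suc m) x = x \<and> x 0 = a}"
  have "(\<Sum>\<^sub>\<infinity>x \<in> {x. (full_shift ^^ Suc m) x = x}.
      ennreal (exp (t * \<phi> (Suc m) x) * indicator (cylinder [a]) x)) = (\<Sum>\<^sub>\<infinity>x \<in> ?P. ennreal (exp (t * \<phi> (Suc m) x)))"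
    by (rule infsum_cong_neutral) (auto simp: cylinder_def)
  also have "\<dots> = (\<Sum>\<^sub>\<infinity>v \<in> {v. length v = m}. ennreal (exp (t * \<phi> (Suc m) (?g v))))"
    by (rule infsum_reindex_bij_betw[OF bij_betw_periodic_points, symmetric])
  also have "\<dots> = (\<Sum>\<^sub>\<infinity>v \<in> {v. length v = m}. ennreal (r (a # v) powr t))"
  proof (rule infsum_cong)
    fix v :: "nat list" assume "v \<in> {v. length v = m}"
    then have "\<phi> (Suc m) (?g v) = ln (r (a # v))"
      using potential[of "a # v" "?g v"] by (auto simp: cylinder_def)
    then show "ennreal (exp (t * \<phi> (Suc m) (?g v))) = ennreal (r (a # v) powr t)"
      using length_pos[of "a # v"] by (simp add: powr_def)
  qed
  also have "\<dots> = Zfrom a t m"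
    unfolding Zfrom_def by (rule infsum_ennreal_eq_nn_integral)
  finally show ?thesis .
qed

lemma gurevich_pressure_eqI:
  assumes "(\<lambda>m. ereal (1 / real (Suc m)) * ln_ennreal (Zfrom a t m)) \<longlonglongrightarrow> L"
  shows "gurevich_pressure a (\<lambda>n x. t * \<phi> n x) = L"
  unfolding gurevich_pressure_def
  by (intro limI, rule LIMSEQ_imp_Suc) (unfold partition_sum_eq, rule assms)

lemma gurevich_pressure_infinite:
  assumes inf: "Z t 1 = \<infinity>"
  shows "gurevich_pressure a (\<lambda>n x. t * \<phi> n x) = \<infinity>"
proof -
  have Zf: "Zfrom a t m = \<infinity>" if "1 \<le> m" for m
  proof -
    have "Z t m = \<infinity>"
      using Z_finite_iff[OF that, of t] inf by (simp add: less_top[symmetric])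
    moreover have "r [a] \<noteq> 0"
      using length_pos[of "[a]"] by simp
    ultimately show ?thesis
      using Zfrom_bounds(1)[OF that, of t a] by (simp add: ennreal_mult_top top_unique)
  qed
  have "(\<lambda>m. ereal (1 / real (Suc m)) * ln_ennreal (Zfrom a t m)) \<longlonglongrightarrow> \<infinity>"
  \<comment> \<open>For \<open>m = 0\<close> there is the single term \<open>r [a] powr t\<close>,
    so the value is infinite only from \<open>m = 1\<close> on.\<close>
  proof (rule tendsto_eventually, rule eventually_sequentiallyI[of 1])
    fix m :: nat assume "1 \<le> m"
    then show "ereal (1 / real (Suc m)) * ln_ennreal (Zfrom a t m) = \<infinity>"
      using Zf[of m] by (simp add: ln_ennreal_def)
  qed
  then show ?thesis
    by (rule gurevich_pressure_eqI)
qed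

text \<open>The logarithms of \<open>Z t n\<close> are quasi-additive with defect
  \<open>\<bar>t\<bar> * C\<close>, hence linear with slope \<open>L\<close> up to that error. Those
  of \<open>Zfrom a t n\<close> differ from them by a bounded amount, so the pressure is the same
  slope.\<close>

lemma gurevich_pressure_finite:
  assumes fin: "Z t 1 < \<infinity>"
  obtains L where "gurevich_pressure a (\<lambda>n x. t * \<phi> n x) = ereal L"
    and "\<And>n. 1 \<le> n \<Longrightarrow> \<bar>ln (enn2real (Z t n)) - n * L\<bar> \<le> \<bar>t\<bar> * C"
proof -
  define p where "p n = enn2real (Z t n)" for n
  have p: "Z t n = ennreal (p n)" "0 < p n" if "1 \<le> n" for n
    using Z_finite_iff[OF that, of t] Z_pos[OF that, of t] fin
    by (auto simp: p_def enn2real_positive_iff less_top)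
  define z where "z n = ln (p n)" for n
  have quasi_add: "\<bar>z (n + m) - z n - z m\<bar> \<le> \<bar>t\<bar> * C" if "1 \<le> n" "1 \<le> m" for n m
  proof -
    have pos: "0 < p n" "0 < p m" "0 < p (n + m)"
      using p that by auto
    have "exp (- (\<bar>t\<bar> * C)) * (p n * p m) \<le> p (n + m)"
      using Z_add_bounds(1)[OF that, of t] p that pos by (simp flip: ennreal_mult)
    then have "ln (exp (- (\<bar>t\<bar> * C)) * (p n * p m)) \<le> z (n + m)"
      unfolding z_def using pos by (subst ln_le_cancel_iff) auto
    moreover have "p (n + m) \<le> exp (\<bar>t\<bar> * C) * (p n * p m)"
      using Z_add_bounds(2)[OF that, of t] p that pos by (simp flip: ennreal_mult)
    then have "z (n + m) \<le> ln (exp (\<bar>t\<bar> * C) * (p n * p m))"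
      unfolding z_def using pos by (subst ln_le_cancel_iff) auto
    ultimately show ?thesis
      using pos by (simp add: ln_mult z_def)
  qed
  obtain L where L: "(\<lambda>n. z n / real n) \<longlonglongrightarrow> L" "\<And>n. 1 \<le> n \<Longrightarrow> \<bar>z n - n * L\<bar> \<le> \<bar>t\<bar> * C"
    using quasi_additive_linear[of z "\<bar>t\<bar> * C", OF quasi_add] by blast
  define b where "b n = ln (enn2real (Zfrom a t n))" for n
  \<comment> \<open>\<open>K\<close> dominates the logarithms of both constant factors in
    \<open>Zfrom_bounds\<close>.\<close>
  define K where "K = \<bar>t\<bar> * C + \<bar>t * ln (r [a])\<bar>"
  have ra: "0 < r [a]"
    using length_pos by simp
  have b: "ln_ennreal (Zfrom a t n) = ereal (b n)" "\<bar>b n - z n\<bar> \<le> K" if n: "1 \<le> n" for n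
  proof -
    note bounds = Zfrom_bounds[OF n, where t = t and a = a]
    have "Zfrom a t n < \<infinity>"
      using bounds(2) p[OF n] by (auto simp: ennreal_mult_less_top intro: le_less_trans)
    moreover have "0 < ennreal (exp (- (\<bar>t\<bar> * C)) * r [a] powr t) * Z t n"
      using p[OF n] ra by (simp flip: ennreal_mult)
    then have "0 < Zfrom a t n"
      using bounds(1) by (rule less_le_trans)
    moreover define y where "y = enn2real (Zfrom a t n)"
    ultimately have y: "Zfrom a t n = ennreal y" "0 < y"
      by (auto simp: enn2real_positive_iff less_top)
    then show "ln_ennreal (Zfrom a t n) = ereal (b n)"
      by (simp add: ln_ennreal_def b_def)
    have "exp (- (\<bar>t\<bar> * C)) * r [a] powr t * p n \<le> y"
      using bounds(1) p[OF n] y ra by (simp flip: ennreal_mult)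
    then have "ln (exp (- (\<bar>t\<bar> * C)) * r [a] powr t * p n) \<le> ln y"
      using p[OF n] y ra by (subst ln_le_cancel_iff) auto
    moreover have "y \<le> exp (\<bar>t\<bar> * C) * r [a] powr t * p n"
      using bounds(2) p[OF n] y ra by (simp flip: ennreal_mult)
    then have "ln y \<le> ln (exp (\<bar>t\<bar> * C) * r [a] powr t * p n)"
      using p[OF n] y ra by (subst ln_le_cancel_iff) auto
    ultimately show "\<bar>b n - z n\<bar> \<le> K"
      using p[OF n] ra by (simp add: b_def y_def[symmetric] z_def K_def ln_mult ln_powr)
  qed
  have "(\<lambda>n. (b n - z n) * (1 / real (Suc n))) \<longlonglongrightarrow> 0"
  proof (rule tendsto_0_le[where K = K])
    show "(\<lambda>n. 1 / real (Suc n)) \<longlonglongrightarrow> 0"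
      by (rule LIMSEQ_Suc[OF lim_1_over_n])
    show "\<forall>\<^sub>F n in sequentially. norm ((b n - z n) * (1 / real (Suc n))) \<le> norm (1 / real (Suc n)) * K"
    proof (rule eventually_sequentiallyI[of 1])
      fix n :: nat assume "1 \<le> n"
      then show "norm ((b n - z n) * (1 / real (Suc n))) \<le> norm (1 / real (Suc n)) * K"
        using b(2)[of n] unfolding norm_mult by (subst mult.commute) (intro mult_left_mono, auto)
    qed
  qed
  \<comment> \<open>The period is \<open>Suc n\<close> while \<open>z n\<close> grows like
    \<open>n * L\<close>; the quotient \<open>n / Suc n\<close> corrects the shift.\<close>
  moreover have "(\<lambda>n. z n / real n * (real n / real (Suc n))) \<longlonglongrightarrow> L * 1"
    by (intro tendsto_mult L(1) LIMSEQ_n_over_Suc_n)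
  ultimately have "(\<lambda>n. (b n - z n) * (1 / real (Suc n)) + z n / real n * (real n / real (Suc n))) \<longlonglongrightarrow> 0 + L * 1"
    by (rule tendsto_add)
  then have "(\<lambda>n. ereal ((b n - z n) * (1 / real (Suc n)) + z n / real n * (real n / real (Suc n)))) \<longlonglongrightarrow> ereal L"
    by simp
  then have "(\<lambda>n. ereal (1 / real (Suc n)) * ln_ennreal (Zfrom a t n)) \<longlonglongrightarrow> ereal L"
  proof (rule Lim_transform_eventually)
    show "\<forall>\<^sub>F n in sequentially. ereal ((b n - z n) * (1 / real (Suc n)) + z n / real n * (real n / real (Suc n))) =
        ereal (1 / real (Suc n)) * ln_ennreal (Zfrom a t n)"
    proof (rule eventually_sequentiallyI[of 1])
      fix n :: nat assume "1 \<le> n"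
      then show "ereal ((b n - z n) * (1 / real (Suc n)) + z n / real n * (real n / real (Suc n))) =
          ereal (1 / real (Suc n)) * ln_ennreal (Zfrom a t n)"
        by (simp add: b diff_divide_distrib)
    qed
  qed
  then have "gurevich_pressure a (\<lambda>n x. t * \<phi> n x) = ereal L"
    by (rule gurevich_pressure_eqI)
  then show thesis
    using that L(2) by (simp add: z_def p_def)
qed

text \<open>Turns a statement about a limit into one about every single level, the form in which
  covers and the tree argument use it. If \<open>Z t 1\<close> is infinite, both sides fail.\<close>

lemma gurevich_pressure_le_0_iff:
  "gurevich_pressure a (\<lambda>n x. t * \<phi> n x) \<le> 0 \<longleftrightarrow> (\<forall>n\<ge>1. Z t n \<le> ennreal (exp (\<bar>t\<bar> * C)))"
proof (cases "Z t 1 < \<infinity>")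
  case False
  then have inf: "Z t 1 = \<infinity>"
    by (simp add: less_top[symmetric])
  have "\<not> Z t 1 \<le> ennreal (exp (\<bar>t\<bar> * C))"
    using inf by (simp add: top_unique)
  then show ?thesis
    using gurevich_pressure_infinite[OF inf] by auto
next
  case fin: True
  obtain L where P: "gurevich_pressure a (\<lambda>n x. t * \<phi> n x) = ereal L"
    and L: "\<And>n. 1 \<le> n \<Longrightarrow> \<bar>ln (enn2real (Z t n)) - n * L\<bar> \<le> \<bar>t\<bar> * C"
    using gurevich_pressure_finite[OF fin, where a = a] by metis
  have pos: "0 < enn2real (Z t n)" and eq: "Z t n = ennreal (enn2real (Z t n))" if "1 \<le> n" for n
    using Z_finite_iff[OF that, of t] Z_pos[OF that, of t] fin
    by (auto simp: enn2real_positive_iff less_top)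
  have iff: "Z t n \<le> ennreal (exp (\<bar>t\<bar> * C)) \<longleftrightarrow> ln (enn2real (Z t n)) \<le> \<bar>t\<bar> * C" if "1 \<le> n" for n
    using pos[OF that] by (subst eq[OF that]) (use ln_le_cancel_iff[of "enn2real (Z t n)" "exp (\<bar>t\<bar> * C)"] in simp)
  have "L \<le> 0" if bound: "\<forall>n\<ge>1. ln (enn2real (Z t n)) \<le> \<bar>t\<bar> * C"
  proof (rule ccontr)
    assume "\<not> L \<le> 0"
    \<comment> \<open>One \<open>\<bar>t\<bar> * C\<close> outweighs the deviation from
      \<open>n * L\<close>, the other the assumed bound.\<close>
    then obtain n :: nat where n: "2 * \<bar>t\<bar> * C < n * L"
      using reals_Archimedean3[of L] by (auto simp: not_le)
    moreover have "0 \<le> 2 * \<bar>t\<bar> * C"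
      using C_pos by simp
    ultimately have "n \<noteq> 0"
      by (intro notI) simp
    then show False
      using L[of n] bound[rule_format, of n] n by simp
  qed
  moreover have "ln (enn2real (Z t n)) \<le> \<bar>t\<bar> * C" if "L \<le> 0" "1 \<le> n" for n
    using L[OF that(2)] mult_nonneg_nonpos[of "real n" L] that(1) by simp
  ultimately show ?thesis
    unfolding P by (auto simp: iff)
qed

end

section \<open>The dimension of the limit set\<close>

text \<open>Lengths are at most 1, so each of the infinitely many first-level terms is at least 1.
  Hence only positive \<open>t\<close> can have nonpositive pressure.\<close>

lemma (in quasi_multiplicative_construction) Z_nonpos_infinite:
  assumes "t \<le> 0"
  shows "Z t 1 = \<infinity>"
proof -
  have "infinite {w :: nat list. length w = 1}"
  proof
    assume "finite {w :: nat list. length w = 1}"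
    then have "finite ((\<lambda>i :: nat. [i]) -` {w. length w = 1})"
      by (intro finite_vimageI) (auto simp: inj_on_def)
    then show False by simp
  qed
  then have "\<infinity> = (\<integral>\<^sup>+w. 1 \<partial>count_space {w :: nat list. length w = 1})"
    by simp
  also have "\<dots> \<le> Z t 1"
    unfolding Z_def
  proof (rule nn_integral_mono)
    fix w :: "nat list" assume "w \<in> space (count_space {w. length w = 1})"
    then have "w \<noteq> []" by auto
    then have "1 \<le> r w powr t"
      using powr_mono'[OF assms, of "r w"] r_le_1[of w] length_pos[of w] by simp
    then show "1 \<le> ennreal (r w powr t)"
      using ennreal_leI[of 1 "r w powr t"] by simp
  qed
  finally show ?thesis
    by (simp add: top_unique)
qed

lemma (in quasi_multiplicative_construction) hausdorff_measure_limit_set_eq_0: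
  assumes t: "0 < t" "\<And>n. 1 \<le> n \<Longrightarrow> Z t n \<le> ennreal B" "0 \<le> B" and "t < t'"
  shows "hausdorff_measure t' (limit_set \<Delta>) = 0"
proof (rule hausdorff_measure_eq_0I)
  fix \<delta> \<epsilon> :: real assume pos: "0 < \<delta>" "0 < \<epsilon>"
  obtain \<theta> where \<theta>: "0 < \<theta>" "\<theta> < 1" "\<And>w. w \<noteq> [] \<Longrightarrow> r w \<le> \<theta> ^ (length w - 1)"
    using exponential_decay by blast
  \<comment> \<open>In \<open>r w powr t' = r w powr (t' - t) * r w powr t\<close> the first factor
    is at most \<open>\<kappa> ^ m\<close> at level \<open>Suc m\<close>, which beats the bound
    \<open>B\<close>.\<close>
  define \<kappa> where "\<kappa> = \<theta> powr (t' - t)"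
  have \<kappa>: "0 < \<kappa>" "\<kappa> < 1"
    using \<theta> \<open>t < t'\<close> powr_less_mono2[of "t' - t" \<theta> 1] by (auto simp: \<kappa>_def)
  have "(\<lambda>n. \<theta> ^ n) \<longlonglongrightarrow> 0" "(\<lambda>n. \<kappa> ^ n * B) \<longlonglongrightarrow> 0"
    using \<theta> \<kappa> by (auto intro!: LIMSEQ_power_zero tendsto_mult_left_zero)
  then have "\<forall>\<^sub>F n in sequentially. \<theta> ^ n < \<delta> \<and> \<kappa> ^ n * B < \<epsilon>"
    using pos by (intro eventually_conj order_tendstoD(2))
  then obtain m where m: "\<theta> ^ m < \<delta>" "\<kappa> ^ m * B < \<epsilon>"
    by (auto simp: eventually_sequentially)
  let ?A = "{w :: nat list. length w = Suc m}"
  \<comment> \<open>Covers are sequences, so each interval of level \<open>Suc m\<close> is placed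
    at the code of its word and the other entries are empty.\<close>
  define U where "U i = (if i \<in> to_nat ` ?A then \<Delta> (from_nat i) else {})" for i
  have U: "U (to_nat w) = \<Delta> w" if "w \<in> ?A" for w
    using that by (auto simp: U_def)
  have diam: "bounded (\<Delta> w)" "diameter (\<Delta> w) = r w" if "w \<in> ?A" for w
  proof -
    have "w \<noteq> []" using that by auto
    then show "bounded (\<Delta> w)" "diameter (\<Delta> w) = r w"
      using length_pos[of w] by (simp_all add: \<Delta>_eq)
  qed
  have cover: "limit_set \<Delta> \<subseteq> (\<Union>i. U i)"
  proof
    fix x assume "x \<in> limit_set \<Delta>"
    then obtain w where "w \<in> ?A" "x \<in> \<Delta> w"
      unfolding limit_set_def by (auto dest: bspec[of _ _ "Suc m"])
    then show "x \<in> (\<Union>i. U i)"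
      using U[of w] by blast
  qed
  have small: "bounded (U i) \<and> diameter (U i) \<le> \<delta>" for i
  proof (cases "i \<in> to_nat ` ?A")
    case True
    then obtain w where w: "w \<in> ?A" "i = to_nat w" by blast
    moreover have "r w \<le> \<theta> ^ m"
      using \<theta>(3)[of w] w by fastforce
    ultimately show ?thesis
      using U[OF w(1)] diam[OF w(1)] m(1) by simp
  qed (use pos in \<open>simp add: U_def\<close>)
  have "(\<Sum>i. ennreal (hausdorff_weight t' (U i))) =
      (\<integral>\<^sup>+i. ennreal (hausdorff_weight t' (U i)) \<partial>count_space UNIV)"
    by (rule nn_integral_count_space_nat[symmetric])
  also have "\<dots> = (\<integral>\<^sup>+i. ennreal (hausdorff_weight t' (U i)) \<partial>count_space (to_nat ` ?A))"
    by (rule nn_integral_count_space_eq) (auto simp: U_def hausdorff_weight_def)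
  also have "\<dots> = (\<integral>\<^sup>+w. ennreal (hausdorff_weight t' (U (to_nat w))) \<partial>count_space ?A)"
    by (rule nn_integral_bij_count_space[symmetric]) (simp add: bij_betw_def)
  also have "\<dots> \<le> (\<integral>\<^sup>+w. ennreal (\<kappa> ^ m) * ennreal (r w powr t) \<partial>count_space ?A)"
  proof (rule nn_integral_mono)
    fix w assume "w \<in> space (count_space ?A)"
    then have w: "w \<in> ?A" by simp
    then have "w \<noteq> []" by auto
    then have r: "0 < r w" "r w \<le> \<theta> ^ m"
      using length_pos[of w] \<theta>(3)[of w] w by auto
    then have "hausdorff_weight t' (\<Delta> w) = r w powr t'"
      using diam(2)[OF w] t \<open>t < t'\<close> \<open>w \<noteq> []\<close> by (simp add: hausdorff_weight_def \<Delta>_eq)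
    also have "\<dots> = r w powr (t' - t) * r w powr t"
      by (simp flip: powr_add)
    also have "\<dots> \<le> (\<theta> ^ m) powr (t' - t) * r w powr t"
      using r \<open>t < t'\<close> by (intro mult_right_mono powr_mono2) auto
    also have "(\<theta> ^ m) powr (t' - t) = \<kappa> ^ m"
      using \<theta>(1) by (simp add: \<kappa>_def powr_power flip: powr_realpow powr_powr) (simp add: powr_powr mult.commute)
    finally show "ennreal (hausdorff_weight t' (U (to_nat w))) \<le> ennreal (\<kappa> ^ m) * ennreal (r w powr t)"
      unfolding U[OF w] using \<kappa> by (simp add: ennreal_leI flip: ennreal_mult)
  qed
  also have "\<dots> = ennreal (\<kappa> ^ m) * Z t (Suc m)"
    unfolding Z_def by (rule nn_integral_cmult) simp
  also have "\<dots> \<le> ennreal (\<kappa> ^ m) * ennreal B"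
    using t(2)[of "Suc m"] by (intro mult_left_mono) auto
  also have "\<dots> \<le> ennreal \<epsilon>"
    using m(2) \<kappa> \<open>0 \<le> B\<close> by (simp add: ennreal_leI flip: ennreal_mult)
  finally show "\<exists>U. limit_set \<Delta> \<subseteq> (\<Union>i. U i) \<and> (\<forall>i. bounded (U i) \<and> diameter (U i) \<le> \<delta>) \<and>
      (\<Sum>i. ennreal (hausdorff_weight t' (U i))) \<le> ennreal \<epsilon>"
    using cover small by blast
qed

lemma (in quasi_multiplicative_construction) Z_le_if_hausdorff_measure_0:
  assumes s: "0 < s" and zero: "hausdorff_measure s (limit_set \<Delta>) = 0" and n: "1 \<le> n"
  shows "Z s n \<le> ennreal (exp (s * C))"
proof (rule ccontr)
  assume "\<not> ?thesis"
  then have "ennreal (exp (s * C)) < (\<Sum>\<^sub>\<infinity>w \<in> {w. length w = n}. ennreal (r w powr s))"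
    by (simp add: Z_def infsum_ennreal_eq_nn_integral)
  \<comment> \<open>The infinite sum is a supremum of finite ones. Finiteness of \<open>W\<close>
    also makes the minimal ratio \<open>c\<close> below positive.\<close>
  then obtain W where W: "finite W" "W \<subseteq> {w. length w = n}"
    and "ennreal (exp (s * C)) < (\<Sum>w\<in>W. ennreal (r w powr s))"
    unfolding nonneg_infsum_complete[OF zero_le] less_SUP_iff by blast
  then have big: "exp (s * C) < (\<Sum>w\<in>W. r w powr s)"
    by (simp add: ennreal_less_iff)
  then have "W \<noteq> {}" by auto
  have W_ne: "w \<noteq> []" if "w \<in> W" for w
    using W n that by auto
  have concat_ne: "concat v \<noteq> []" if "v \<in> lists W" "v \<noteq> []" for v
    using that W_ne by (cases v) auto
  have len_concat: "length (concat v) = n * length v" if "v \<in> lists W" for v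
    using that W by (induction v) auto
  \<comment> \<open>The factor \<open>exp (- C)\<close> absorbs the loss of one concatenation, so
    products of \<open>q\<close> bound lengths from below without accumulating constants.\<close>
  define q where "q w = exp (- C) * r w" for w
  have q_pos: "0 < q w" if "w \<in> W" for w
    using length_pos[OF W_ne[OF that]] by (simp add: q_def)
  define c where "c = Min (q ` W)"
  have c: "0 < c" "c \<le> q w" if "w \<in> W" for w
    using q_pos \<open>finite W\<close> \<open>W \<noteq> {}\<close> that by (auto simp: c_def)
  \<comment> \<open>The root is set to the unit interval by hand, as \<open>\<Delta> []\<close> is
    unspecified.\<close>
  define left' where "left' v = (if v = [] then 0 else left (concat v))" for v
  define len' where "len' v = (if v = [] then 1 else r (concat v))" for v
  have ival_eq: "{left' v .. left' v + len' v} = (if v = [] then {0..1} else \<Delta> (concat v))" if "v \<in> lists W" for v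
    using concat_ne[OF that] by (auto simp: left'_def len'_def \<Delta>_eq)
  have len_child: "q w * len' v \<le> len' (v @ [w])" if "v \<in> lists W" "w \<in> W" for v w
  proof (cases "v = []")
    case True
    then show ?thesis
      using length_pos[OF W_ne[OF that(2)]] C_pos by (simp add: len'_def q_def)
  next
    case False
    then show ?thesis
      using quasi_mult[OF concat_ne[OF that(1)] W_ne[OF that(2)]] by (simp add: len'_def q_def mult.commute mult.left_commute)
  qed
  interpret interval_tree W left' len' c
  proof
    show "finite W" "0 < c"
      using W c \<open>W \<noteq> {}\<close> by auto
    show len_pos: "0 < len' v" if "v \<in> lists W" for v
      using length_pos[OF concat_ne[OF that]] by (simp add: len'_def)
    fix v w assume v: "v \<in> lists W" and w: "w \<in> W"
    then have vw: "v @ [w] \<in> lists W" by simp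
    show "{left' (v @ [w]) .. left' (v @ [w]) + len' (v @ [w])} \<subseteq> {left' v .. left' v + len' v}"
      unfolding ival_eq[OF v] ival_eq[OF vw]
      using \<Delta>_unit[OF W_ne[OF w]] \<Delta>_append_subset[OF concat_ne[OF v], of w] by simp
    have "c * len' v \<le> q w * len' v"
      using c(2)[OF w] len_pos[OF v] by (intro mult_right_mono) auto
    then show "c * len' v \<le> len' (v @ [w])"
      using len_child[OF v w] by linarith
    fix w' assume w': "w' \<in> W" "w \<noteq> w'"
    \<comment> \<open>Distinct words of equal length branch apart, neither being a prefix of the
      other.\<close>
    then have "length w = length w'"
      using w W by auto
    then have "concat v @ w \<parallel> concat v @ w'"
      using w'(2) by (intro not_equal_is_parallel) auto
    then show "{left' (v @ [w]) .. left' (v @ [w]) + len' (v @ [w])} \<inter>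
        {left' (v @ [w']) .. left' (v @ [w']) + len' (v @ [w'])} = {}"
      using \<Delta>_disjoint ival_eq[OF vw] ival_eq[of "v @ [w']"] v w' by simp
  qed
  have q_le: "prod_list (map (\<lambda>w. q w powr s) v) \<le> len' v powr s" if "v \<in> lists W" for v
    using that
  proof (induction v rule: rev_induct)
    case (snoc w v)
    then have vw: "v \<in> lists W" "w \<in> W" by auto
    have "prod_list (map (\<lambda>w. q w powr s) (v @ [w])) \<le> len' v powr s * q w powr s"
      using snoc.IH[OF vw(1)] by (simp add: mult_right_mono)
    also have "\<dots> = (q w * len' v) powr s"
      using q_pos[OF vw(2)] len_pos[OF vw(1)] by (simp add: powr_mult mult.commute)
    also have "\<dots> \<le> len' (v @ [w]) powr s"
      using len_child[OF vw] q_pos[OF vw(2)] len_pos[OF vw(1)] s by (intro powr_mono2) auto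
    finally show ?case .
  qed (simp add: len'_def)
  \<comment> \<open>The factor in \<open>q\<close> costs exactly \<open>exp (- (s * C))\<close>, the
    excess that \<open>W\<close> was chosen to have.\<close>
  have sum_q: "1 \<le> (\<Sum>w\<in>W. q w powr s)"
  proof -
    have "(\<Sum>w\<in>W. q w powr s) = (\<Sum>w\<in>W. exp (- (s * C)) * r w powr s)"
    proof (rule sum.cong)
      fix w assume "w \<in> W"
      then have "0 < r w"
        using length_pos W_ne by blast
      then show "q w powr s = exp (- (s * C)) * r w powr s"
        by (simp add: q_def powr_mult exp_powr_real mult.commute)
    qed simp
    also have "\<dots> = exp (- (s * C)) * (\<Sum>w\<in>W. r w powr s)"
      by (simp add: sum_distrib_left)
    also have "\<dots> \<ge> exp (- (s * C)) * exp (s * C)"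
      using big by (intro mult_left_mono) auto
    finally show ?thesis
      by (simp flip: exp_add)
  qed
  have paths: "map x [0..<k] \<in> lists W" if "\<And>k. x k \<in> W" for x :: "nat \<Rightarrow> nat list" and k
    using that by (auto simp: lists_eq_set)
  have "hausdorff_measure s (limit_set \<Delta>) \<noteq> 0"
  proof (rule hausdorff_measure_pos[where q = "\<lambda>w. q w powr s"])
    show "z \<in> limit_set \<Delta>" if x: "\<And>k. x k \<in> W" and z: "\<And>k. z \<in> ival (map x [0..<k])" for x z
      unfolding limit_set_def
    proof (intro INT_I)
      fix k :: nat assume k: "k \<in> {1..}"
      \<comment> \<open>The \<open>k\<close> blocks have \<open>n * k \<ge> k\<close> letters, so
        their interval lies in a level-\<open>k\<close> interval, that of the first \<open>k\<close>
        letters.\<close>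
      let ?u = "concat (map x [0..<k])"
      have "z \<in> \<Delta> ?u"
        using z[of k] ival_eq[OF paths[of x k, OF x]] k by (simp add: ival_def)
      moreover have "length (take k ?u) = k"
        using len_concat[OF paths[of x k, OF x]] n by simp
      moreover have "take k ?u \<noteq> []"
        using calculation(2) k by (metis atLeast_iff list.size(3) not_one_le_zero)
      then have "\<Delta> ?u \<subseteq> \<Delta> (take k ?u)"
        using \<Delta>_append_subset[of "take k ?u" "drop k ?u"] by simp
      ultimately show "z \<in> (\<Union>w\<in>{w. length w = k}. \<Delta> w)"
        by blast
    qed
    show "(\<lambda>k. len' (map x [0..<k])) \<longlonglongrightarrow> 0" if x: "\<And>k. x k \<in> W" for x
    proof -
      obtain \<theta> where \<theta>: "0 < \<theta>" "\<theta> < 1" "\<And>w. w \<noteq> [] \<Longrightarrow> r w \<le> \<theta> ^ (length w - 1)"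
        using exponential_decay by blast
      \<comment> \<open>\<open>Suc k\<close> blocks have at least \<open>Suc k\<close> letters,
        whence the exponent \<open>k\<close>; the shift skips the root.\<close>
      have le: "len' (map x [0..<Suc k]) \<le> \<theta> ^ k" for k
      proof -
        let ?u = "concat (map x [0..<Suc k])"
        have u: "length ?u = n * Suc k" "?u \<noteq> []"
          using len_concat[OF paths[of x "Suc k", OF x]] concat_ne[OF paths[of x "Suc k", OF x]] by auto
        have "len' (map x [0..<Suc k]) \<le> \<theta> ^ (n * Suc k - 1)"
          using \<theta>(3)[OF u(2)] u(1) by (simp add: len'_def)
        also have "\<dots> \<le> \<theta> ^ k"
          using \<theta> mult_right_mono[OF n, of "Suc k"] by (intro power_decreasing) auto
        finally show ?thesis .
      qed
      have "(\<lambda>k. len' (map x [0..<Suc k])) \<longlonglongrightarrow> 0"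
      proof (rule tendsto_sandwich[of "\<lambda>_. 0" _ _ "\<lambda>k. \<theta> ^ k"])
        show "\<forall>\<^sub>F k in sequentially. 0 \<le> len' (map x [0..<Suc k])"
          using len_pos[OF paths[of x, OF x]] by (intro always_eventually allI less_imp_le)
        show "\<forall>\<^sub>F k in sequentially. len' (map x [0..<Suc k]) \<le> \<theta> ^ k"
          using le by (intro always_eventually allI)
        show "(\<lambda>k. \<theta> ^ k) \<longlonglongrightarrow> 0"
          using \<theta> by (intro LIMSEQ_power_zero) simp
      qed simp
      then show ?thesis
        by (rule LIMSEQ_imp_Suc)
    qed
  qed (use s sum_q q_le in auto)
  with zero show False by simp
qed

theorem theorem8p1:
  fixes \<Delta> :: "nat list \<Rightarrow> real set" and r :: "nat list \<Rightarrow> real"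
    and \<phi> :: "nat \<Rightarrow> (nat \<Rightarrow> nat) \<Rightarrow> real" and a :: nat
  assumes "geometric_construction \<Delta> r"
    and "\<exists>C>0. \<forall>u v. u \<noteq> [] \<longrightarrow> v \<noteq> [] \<longrightarrow>
           r u * r v * exp (- C) \<le> r (u @ v) \<and> r (u @ v) \<le> r u * r v * exp C"
    and "\<And>w x. w \<noteq> [] \<Longrightarrow> x \<in> cylinder w \<Longrightarrow> \<phi> (length w) x = ln (r w)"
  shows "hausdorff_dim (limit_set \<Delta>) =
           (INF t \<in> {t::real. gurevich_pressure a (\<lambda>n x. t * \<phi> n x) \<le> 0}. ereal t)"
proof -
  obtain C where C: "0 < C" "\<And>u v. u \<noteq> [] \<Longrightarrow> v \<noteq> [] \<Longrightarrow>
      r u * r v * exp (- C) \<le> r (u @ v) \<and> r (u @ v) \<le> r u * r v * exp C"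
    using assms(2) by blast
  interpret quasi_multiplicative_construction \<Delta> r C \<phi>
    using assms(1,3) C by (intro quasi_multiplicative_construction.intro quasi_multiplicative_construction_axioms.intro)
  let ?T = "{t. gurevich_pressure a (\<lambda>n x. t * \<phi> n x) \<le> 0}"
  show ?thesis
  proof (rule antisym)
    show "hausdorff_dim (limit_set \<Delta>) \<le> (INF t \<in> ?T. ereal t)"
    proof (rule INF_greatest)
      fix t assume "t \<in> ?T"
      then have Z_le: "Z t n \<le> ennreal (exp (\<bar>t\<bar> * C))" if "1 \<le> n" for n
        using gurevich_pressure_le_0_iff that by simp
      have "0 < t"
        using Z_nonpos_infinite[of t] Z_le[of 1] by (force simp: top_unique)
      \<comment> \<open>Bounded partition sums give null measure only strictly beyond
        \<open>t\<close>, so the exponents \<open>t + e\<close> are used and \<open>e\<close> tends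
        to 0.\<close>
      have "hausdorff_dim (limit_set \<Delta>) \<le> ereal t + ereal e" if "0 < e" for e
      proof -
        have "hausdorff_measure (t + e) (limit_set \<Delta>) = 0"
          using hausdorff_measure_limit_set_eq_0[OF \<open>0 < t\<close> Z_le] that by simp
        then show ?thesis
          unfolding hausdorff_dim_def using \<open>0 < t\<close> that by (intro INF_lower2[of "t + e"]) auto
      qed
      then show "hausdorff_dim (limit_set \<Delta>) \<le> ereal t"
        by (rule ereal_le_epsilon2[rule_format])
    qed
    have in_T: "s \<in> ?T" if "0 < s" "hausdorff_measure s (limit_set \<Delta>) = 0" for s
      using gurevich_pressure_le_0_iff[of a s] Z_le_if_hausdorff_measure_0[OF that] that(1) by simp
    show "(INF t \<in> ?T. ereal t) \<le> hausdorff_dim (limit_set \<Delta>)"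
      unfolding hausdorff_dim_def
    proof (rule INF_greatest)
      fix s assume "s \<in> {s. 0 \<le> s \<and> hausdorff_measure s (limit_set \<Delta>) = 0}"
      then have s: "0 \<le> s" "hausdorff_measure s (limit_set \<Delta>) = 0"
        by auto
      show "(INF t \<in> ?T. ereal t) \<le> ereal s"
      proof (cases "s = 0")
        case False
        then show ?thesis
          using in_T[of s] s by (intro INF_lower) auto
      next
        \<comment> \<open>The tree argument requires a positive exponent. At exponent 0 null measure
          forces an empty limit set, which is null for every \<open>e > 0\<close>, so all these
          \<open>e\<close> lie in \<open>?T\<close>.\<close>
        case True
        then have "limit_set \<Delta> = {}"
          using s(2) hausdorff_measure_0_eq_0D by blast
        then have "(INF t \<in> ?T. ereal t) \<le> ereal 0 + ereal e" if "0 < e" for e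
          using in_T[OF that] that by (intro INF_lower2[of e]) (auto simp: hausdorff_measure_empty)
        then show ?thesis
          unfolding True by (rule ereal_le_epsilon2[rule_format])
      qed
    qed
  qed
qed

end
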